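(* Let $n\geq 1$ be an integer. For every $\varepsilon>0$ there exist an integer $d\geq 1$ and an $n$-dimensional linear subspace $E\subset \ell_1^d$ such that \[ \Pi_n-\varepsilon\leq \lVert P\rVert\leq \Pi(E,\ell_1^d)+\varepsilon, \] where $P\colon \ell_1^d\to E$ denotes the orthogonal projection of $\ell_1^d$ onto $E$ and $\lVert P\rVert$ is its operator norm with respect to the $\ell_1$-norm.
   Context: All Banach spaces are real. For a finite-dimensional linear subspace $E$ of a Banach space $F$, the projection constant of $E$ relative to $F$, $\Pi(E,F)$, is the minimal operator norm of a linear projection of $F$ onto $E$. The (absolute) projection constant of a finite-dimensional Banach space $E$ is $\Pi(E):=\Pi(E,\ell_\infty)$, where $E$ is regarded as a subspace of $\ell_\infty$ via a linear isometric embedding (the value does not depend on the embedding). The maximal projection constant of order $n$ is $\Pi_n:=\max\{\Pi(E): E \text{ a real Banach space},\ \dim(E)=n\}$. The space $\ell_1^d$ is $\mathbb{R}^d$ with the $\ell_1$-norm; a subspace carries the induced norm. The orthogonal projection onto a linear subspace $E\subset\mathbb{R}^d$ is orthogonal with respect to the standard inner product of $\mathbb{R}^d$. *)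

theory Defs
  imports "HOL-Analysis.Analysis" "HOL-Analysis.Finite_Function_Topology"
begin

definition linear_on :: "'a::real_vector set \<Rightarrow> ('a \<Rightarrow> 'b::real_vector) \<Rightarrow> bool" where
  "linear_on V f \<longleftrightarrow>
     (\<forall>x\<in>V. \<forall>y\<in>V. f (x + y) = f x + f y) \<and> (\<forall>c. \<forall>x\<in>V. f (c *\<^sub>R x) = c *\<^sub>R f x)"

definition op_norm_on ::
    "'a::real_normed_vector set \<Rightarrow> ('a \<Rightarrow> 'b::real_normed_vector) \<Rightarrow> real" where
  "op_norm_on V f = (SUP x\<in>V. norm (f x) / norm x)"

lemma op_norm_on_UNIV: "op_norm_on UNIV f = onorm f"
  by (simp add: op_norm_on_def onorm_def)

text \<open>Boundedness is required because the real-valued supremum in \<open>op_norm_on\<close> is meaningful only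
  for bounded operators.\<close>

definition bounded_projection ::
    "'a::real_normed_vector set \<Rightarrow> 'a set \<Rightarrow> ('a \<Rightarrow> 'a) \<Rightarrow> bool" where
  "bounded_projection E F P \<longleftrightarrow>
     linear_on F P \<and> P ` F \<subseteq> E \<and> (\<forall>x\<in>E. P x = x) \<and> (\<exists>B. \<forall>x\<in>F. norm (P x) \<le> B * norm x)"

text \<open>\<open>\<Pi>(E, F)\<close> for subspaces \<open>E \<subseteq> F\<close> of an ambient normed space, with \<open>E\<close> finite-dimensional.
  The minimal norm is written as an infimum.\<close>

definition rel_proj_const :: "'a::real_normed_vector set \<Rightarrow> 'a set \<Rightarrow> real" where
  "rel_proj_const E F = Inf {op_norm_on F P | P. bounded_projection E F P}"

text \<open>
  An abstract normed space is given by a linear subspace \<open>V\<close> of some real vector space together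
  with a function \<open>N\<close> that is a norm on \<open>V\<close>; the values of \<open>N\<close> outside \<open>V\<close> are irrelevant.
\<close>

definition norm_on :: "'a::real_vector set \<Rightarrow> ('a \<Rightarrow> real) \<Rightarrow> bool" where
  "norm_on V N \<longleftrightarrow>
     (\<forall>x\<in>V. 0 \<le> N x \<and> (N x = 0 \<longleftrightarrow> x = 0)) \<and>
     (\<forall>c. \<forall>x\<in>V. N (c *\<^sub>R x) = \<bar>c\<bar> * N x) \<and>
     (\<forall>x\<in>V. \<forall>y\<in>V. N (x + y) \<le> N x + N y)"

text \<open>The space \<open>\<ell>\<^sub>\<infinity>\<close> with its supremum norm: \<open>nat\<close> has the discrete topology, so the continuity
  condition is void.\<close>

type_synonym linfty = "nat \<Rightarrow>\<^sub>C real"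

definition isometric_embedding ::
    "'a::real_vector set \<Rightarrow> ('a \<Rightarrow> real) \<Rightarrow> ('a \<Rightarrow> linfty) \<Rightarrow> bool" where
  "isometric_embedding V N j \<longleftrightarrow> linear_on V j \<and> (\<forall>x\<in>V. norm (j x) = N x)"

text \<open>\<open>\<Pi>(V)\<close> for a finite-dimensional normed space \<open>(V, N)\<close>. Its value does not depend on the
  chosen embedding.\<close>

definition abs_proj_const :: "'a::real_vector set \<Rightarrow> ('a \<Rightarrow> real) \<Rightarrow> real" where
  "abs_proj_const V N = rel_proj_const ((SOME j. isometric_embedding V N j) ` V) UNIV"

text \<open>\<open>\<Pi>\<^sub>n\<close>. Every \<open>n\<close>-dimensional real Banach space is linearly isometric to some \<open>(V, N)\<close> with \<open>V\<close> an
  \<open>n\<close>-dimensional space of finitely supported sequences, and every such \<open>(V, N)\<close> is complete. For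
  \<open>n \<ge> 1\<close>, the condition \<open>dim V = n\<close> implies finite dimension. The maximum is written as a
  supremum.\<close>

definition max_proj_const :: "nat \<Rightarrow> real" where
  "max_proj_const n =
     Sup {abs_proj_const V N | (V :: (nat \<Rightarrow>\<^sub>0 real) set) N. subspace V \<and> dim V = n \<and> norm_on V N}"

text \<open>\<open>\<real>\<^sup>d\<close> as the space of sequences supported in \<open>{0, \<dots>, d - 1}\<close>. The library norm on
  \<open>nat \<Rightarrow>\<^sub>0 real\<close> is the sum of the absolute values of the entries, so with it this is \<open>\<ell>\<^sub>1\<^sup>d\<close>.\<close>

definition l1_space :: "nat \<Rightarrow> (nat \<Rightarrow>\<^sub>0 real) set" where
  "l1_space d = {x. Poly_Mapping.keys x \<subseteq> {..<d}}"

lemma norm_l1_space: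
  assumes "x \<in> l1_space d"
  shows "norm x = (\<Sum>i<d. \<bar>Poly_Mapping.lookup x i\<bar>)"
  unfolding norm_poly_mapping_def dist_poly_mapping_def
  by (rule sum.mono_neutral_cong_left)
     (use assms in \<open>auto simp: l1_space_def in_keys_iff dist_real_def\<close>)

lemma lookup_scaleR:
  "Poly_Mapping.lookup (c *\<^sub>R x) i = c *\<^sub>R Poly_Mapping.lookup x i"
proof -
  have "finite {i. c *\<^sub>R Poly_Mapping.lookup x i \<noteq> 0}"
    by (rule finite_subset[OF _ finite_lookup[of x]]) auto
  then show ?thesis
    by (simp add: scaleR_poly_mapping_def)
qed

lemma subspace_l1_space: "subspace (l1_space d)"
proof (rule subspaceI)
  fix x y :: "nat \<Rightarrow>\<^sub>0 real" and c :: real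
  assume x: "x \<in> l1_space d"
  show "x + y \<in> l1_space d" if "y \<in> l1_space d"
    using x that Poly_Mapping.keys_add[of x y] by (auto simp: l1_space_def)
  show "c *\<^sub>R x \<in> l1_space d"
    using x by (auto simp: l1_space_def in_keys_iff lookup_scaleR subset_iff)
qed (simp add: l1_space_def)

definition std_inner :: "nat \<Rightarrow> (nat \<Rightarrow>\<^sub>0 real) \<Rightarrow> (nat \<Rightarrow>\<^sub>0 real) \<Rightarrow> real" where
  "std_inner d x y = (\<Sum>i<d. Poly_Mapping.lookup x i * Poly_Mapping.lookup y i)"

text \<open>For a subspace \<open>E\<close> of \<open>\<real>\<^sup>d\<close>, this determines \<open>P\<close> uniquely on \<open>\<real>\<^sup>d\<close>, and \<open>P\<close> is linear there.\<close>

definition orthogonal_projection ::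
    "nat \<Rightarrow> (nat \<Rightarrow>\<^sub>0 real) set \<Rightarrow> ((nat \<Rightarrow>\<^sub>0 real) \<Rightarrow> (nat \<Rightarrow>\<^sub>0 real)) \<Rightarrow> bool" where
  "orthogonal_projection d E P \<longleftrightarrow>
     (\<forall>x\<in>l1_space d. P x \<in> E \<and> (\<forall>y\<in>E. std_inner d (x - P x) y = 0))"

end

theory Submission
  imports Defs
begin

text \<open>For a finite index set \<open>I\<close>, a nonnegative unit vector \<open>t\<close> on \<open>I\<close> and orthonormal vectors
  \<open>v\<^sub>1, \<dots>, v\<^sub>n\<close> on \<open>I\<close>, let \<open>K\<close> be the matrix of the orthogonal projection onto the span of the
  \<open>v\<^sub>k\<close>, and put \<open>\<Phi>(t, v) = \<Sum>\<^sub>i\<^sub>j t\<^sub>i t\<^sub>j \<bar>K\<^sub>i\<^sub>j\<bar>\<close>. The supremum \<open>\<lambda>\<close> of \<open>\<Phi>\<close> over all \<open>I\<close>, \<open>t\<close>, \<open>v\<close>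
  (\<open>extremal_value\<close>) links the two sides of the theorem.

  First, \<open>\<Pi>\<^sub>n \<le> \<lambda>\<close> (\<open>max_proj_const_le\<close>). An \<open>n\<close>-dimensional space \<open>E\<close> inside \<open>\<ell>\<^sub>\<infinity>\<close> is almost normed
  by finitely many coordinates \<open>I\<close>, so it suffices to find a projection that depends only on the
  coordinates in \<open>I\<close> and whose rows in \<open>I\<close> have small \<open>\<ell>\<^sub>1\<close>-norm. By a minimax argument one may
  replace the maximum over the rows by a fixed weighted average with positive weights \<open>w\<close>. For this
  average the projection that is orthogonal with respect to \<open>\<Sum>\<^sub>i w\<^sub>i x\<^sub>i y\<^sub>i\<close> is good enough: its
  averaged row norm is exactly \<open>\<Phi>(t, v)\<close> with \<open>t\<^sub>i = \<surd>w\<^sub>i\<close>.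

  Second, near-maximisers of \<open>\<Phi>\<close> yield the subspaces of \<open>\<ell>\<^sub>1\<^sup>d\<close>. On a fixed \<open>I\<close>, stationarity in \<open>t\<close>
  says that \<open>t\<close> is an eigenvector of \<open>\<bar>K\<bar>\<close>, and stationarity in \<open>v\<close> says that the span of the
  \<open>v\<^sub>k\<close> is invariant under the matrix \<open>S\<^sub>i\<^sub>j = t\<^sub>i t\<^sub>j sgn K\<^sub>i\<^sub>j\<close>. If all \<open>t\<^sub>i\<close> were equal, the
  eigenvector equation would say that all columns of \<open>K\<close> have the same \<open>\<ell>\<^sub>1\<close>-norm, namely
  \<open>\<Phi>\<close>, which then is the norm of the orthogonal projection; and the invariance would make it a
  minimal projection, since \<open>trace (Q S)\<close> then takes the same value \<open>\<Phi>\<close> for every projection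
  \<open>Q\<close> onto the subspace, whereas the entries of \<open>S\<close> are bounded by \<open>1/d\<close>. Unequal weights are made
  almost equal by replacing each coordinate \<open>i\<close> by about \<open>M t\<^sub>i\<^sup>2\<close> copies of itself
  (\<open>blow_up_extremal_pair\<close>). A small multiple of the all-ones matrix is added to \<open>\<bar>K\<bar>\<close> beforehand, to
  force \<open>t\<^sub>i > 0\<close> (\<open>extremal_pair\<close>).\<close>

section \<open>Extension of functionals in finite dimension\<close>

definition sublinear_on :: "'a::real_vector set \<Rightarrow> ('a \<Rightarrow> real) \<Rightarrow> bool" where
  "sublinear_on V q \<longleftrightarrow> (\<forall>x\<in>V. \<forall>y\<in>V. q (x + y) \<le> q x + q y) \<and>
     (\<forall>a>0. \<forall>x\<in>V. q (a *\<^sub>R x) = a * q x)"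

text \<open>The classical one-dimensional extension: the value at \<open>x\<close> can be any number between the
  supremum of \<open>f u - q (u - x)\<close> and the infimum of \<open>q (v + x) - f v\<close>. Functionals are linear on the
  whole type, and only the domination by \<open>q\<close> is restricted to a subspace.\<close>

lemma hahn_banach_step:
  fixes q :: "'a::real_vector \<Rightarrow> real"
  assumes q: "sublinear_on (span (insert x U)) q"
    and f: "linear f" "\<And>u. u \<in> span U \<Longrightarrow> f u \<le> q u"
  shows "\<exists>g. linear g \<and> (\<forall>u\<in>span U. g u = f u) \<and> (\<forall>u\<in>span (insert x U). g u \<le> q u)"
proof (cases "x \<in> span U")
  case True
  then have "span (insert x U) = span U" by (rule span_redundant)
  then show ?thesis using f by blast
next
  case False
  obtain B where B: "B \<subseteq> U" "independent B" "span B = span U"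
    using maximal_independent_subset[of U] by (metis span_mono span_span subset_antisym)
  have ind: "independent (insert x B)"
    by (rule independent_insertI) (use B False in simp_all)
  obtain \<phi> where phi: "linear \<phi>" "\<forall>b\<in>insert x B. \<phi> b = (if b = x then 1 else (0::real))"
    using linear_independent_extend[OF ind, of "\<lambda>b. if b = x then 1 else (0::real)"] by (elim exE conjE)
  have phix: "\<phi> x = 1" using phi(2) by simp
  have "x \<notin> B" using False B span_base by blast
  then have "\<forall>b\<in>B. \<phi> b = 0" using phi(2) by auto
  then have phiU: "\<phi> u = 0" if "u \<in> span U" for u
    using linear_eq_0_on_span[OF phi(1), of B u] that B(3) by simp
  have inV: "u \<in> span (insert x U)" if "u \<in> span U" for u
    using that span_mono[of U "insert x U"] by blast
  have xV: "x \<in> span (insert x U)" by (simp add: span_base)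
  have subadd: "q (u + v) \<le> q u + q v" if "u \<in> span (insert x U)" "v \<in> span (insert x U)" for u v
    using q that unfolding sublinear_on_def by blast
  have hom: "q (a *\<^sub>R u) = a * q u" if "u \<in> span (insert x U)" "a > 0" for u a
    using q that unfolding sublinear_on_def by blast
  \<comment> \<open>Every lower bound for the value at the new vector is below every upper bound.\<close>
  have key: "f u - q (u - x) \<le> q (v + x) - f v" if "u \<in> span U" "v \<in> span U" for u v
  proof -
    have "f u + f v = f (u + v)" using f(1) by (simp add: linear_add)
    also have "\<dots> \<le> q (u + v)" using that by (intro f(2) span_add)
    also have "\<dots> = q ((u - x) + (v + x))" by simp
    also have "\<dots> \<le> q (u - x) + q (v + x)"
      by (intro subadd span_diff span_add inV that xV)
    finally show ?thesis by simp
  qed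
  define c where "c = (SUP u\<in>span U. f u - q (u - x))"
  have z: "0 \<in> span U" by (rule span_zero)
  have bdd: "bdd_above ((\<lambda>u. f u - q (u - x)) ` span U)"
    by (rule bdd_aboveI2[of _ _ "q (0 + x) - f 0"]) (use key z in blast)
  have lo: "f u - q (u - x) \<le> c" if "u \<in> span U" for u
    unfolding c_def using that bdd by (rule cSUP_upper)
  have hi: "c \<le> q (v + x) - f v" if "v \<in> span U" for v
    unfolding c_def using that key z by (intro cSUP_least) auto
  define g where "g = (\<lambda>y. f y + (c - f x) * \<phi> y)"
  have ling: "linear g"
    unfolding g_def using f(1) phi(1)
    by (intro linearI) (simp_all add: linear_add linear_scale algebra_simps)
  have gU: "g u = f u" if "u \<in> span U" for u
    using phiU[OF that] by (simp add: g_def)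
  have gx: "g x = c" by (simp add: g_def phix)
  have "g y \<le> q y" if y: "y \<in> span (insert x U)" for y
  proof -
    from y obtain a where a: "y - a *\<^sub>R x \<in> span U"
      by (auto simp: span_insert)
    define u where "u = y - a *\<^sub>R x"
    have u: "u \<in> span U" and yu: "y = u + a *\<^sub>R x" using a by (auto simp: u_def)
    have gy: "g y = f u + a * c"
      using ling gU[OF u] gx by (simp add: yu linear_add linear_scale)
    consider "a = 0" | "a > 0" | "a < 0" by linarith
    then show ?thesis
    proof cases
      case 1 then show ?thesis using gy f(2)[OF u] yu by simp
    next
      case 2
      define v where "v = (1 / a) *\<^sub>R u"
      have v: "v \<in> span U" using u by (simp add: v_def span_scale)
      have "a * c \<le> a * (q (v + x) - f v)" using hi[OF v] 2 by simp
      also have "\<dots> = q (a *\<^sub>R (v + x)) - f u"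
        using 2 f(1) hom[of "v + x" a] inV[OF v] xV
        by (simp add: span_add right_diff_distrib v_def linear_scale)
      also have "a *\<^sub>R (v + x) = y" using 2 by (simp add: v_def yu algebra_simps)
      finally show ?thesis using gy by simp
    next
      case 3
      define b where "b = - a"
      have b: "b > 0" using 3 by (simp add: b_def)
      define v where "v = (1 / b) *\<^sub>R u"
      have v: "v \<in> span U" using u by (simp add: v_def span_scale)
      have "b * (f v - q (v - x)) \<le> b * c" using lo[OF v] b by simp
      moreover have "b * (f v - q (v - x)) = f u - q (b *\<^sub>R (v - x))"
        using b f(1) hom[of "v - x" b] inV[OF v] xV
        by (simp add: span_diff right_diff_distrib v_def linear_scale)
      moreover have "b *\<^sub>R (v - x) = y" using b by (simp add: v_def yu algebra_simps b_def)
      ultimately show ?thesis using gy by (simp add: b_def)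
    qed
  qed
  then show ?thesis using ling gU by blast
qed

lemma hahn_banach_finite:
  fixes q :: "'a::real_vector \<Rightarrow> real"
  assumes "finite B" "sublinear_on (span (A \<union> B)) q"
    and "linear f" "\<And>u. u \<in> span A \<Longrightarrow> f u \<le> q u"
  shows "\<exists>g. linear g \<and> (\<forall>u\<in>span A. g u = f u) \<and> (\<forall>u\<in>span (A \<union> B). g u \<le> q u)"
  using assms
proof (induction B)
  case empty
  then show ?case by auto
next
  case (insert x B)
  have sub: "span (A \<union> B) \<subseteq> span (A \<union> insert x B)" by (rule span_mono) auto
  have "sublinear_on (span (A \<union> B)) q"
    using insert.prems(1) sub unfolding sublinear_on_def by blast
  then obtain g where g: "linear g" "\<forall>u\<in>span A. g u = f u" "\<forall>u\<in>span (A \<union> B). g u \<le> q u"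
    using insert by blast
  obtain h where h: "linear h" "\<forall>u\<in>span (A \<union> B). h u = g u"
      "\<forall>u\<in>span (insert x (A \<union> B)). h u \<le> q u"
    using hahn_banach_step[of x "A \<union> B" q g] insert.prems(1) g by auto
  have "span A \<subseteq> span (A \<union> B)" by (rule span_mono) auto
  then show ?case using h g by (intro exI[of _ h]) auto
qed

section \<open>A minimax inequality for finitely many convex functions\<close>

text \<open>If no point \<open>p\<close> has all values \<open>g i p\<close> below \<open>C\<close>, then some convex combination of the functions is
  everywhere at least \<open>C\<close>. The weights come from the Hahn--Banach theorem on \<open>\<real>\<^sup>I\<close>, applied to the
  functional \<open>q(z) = inf {max\<^sub>i (z\<^sub>i + s (g\<^sub>i(p) - C)) | s \<ge> 0, p \<in> S}\<close>. It is finite because of the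
  hypothesis on \<open>C\<close> and subadditive because of the convexity. A linear functional below \<open>q\<close> lies below
  \<open>max\<^sub>i z\<^sub>i\<close> (take \<open>s = 0\<close>), hence is a probability vector, and its value at \<open>C - g(p)\<close> is
  at most \<open>0\<close> (take \<open>s = 1\<close>).\<close>

lemma minimax_weights:
  fixes g :: "nat \<Rightarrow> 'a \<Rightarrow> real" and I :: "nat set"
  assumes I: "finite I" "I \<noteq> {}" and S: "S \<noteq> {}"
    and conv: "\<And>p q u. p \<in> S \<Longrightarrow> q \<in> S \<Longrightarrow> 0 \<le> u \<Longrightarrow> u \<le> 1 \<Longrightarrow>
                 \<exists>r\<in>S. \<forall>i\<in>I. g i r \<le> u * g i p + (1 - u) * g i q"
    and ge: "\<And>p. p \<in> S \<Longrightarrow> \<exists>i\<in>I. C \<le> g i p"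
  shows "\<exists>w. (\<forall>i\<in>I. 0 \<le> w i) \<and> sum w I = 1 \<and> (\<forall>p\<in>S. C \<le> (\<Sum>i\<in>I. w i * g i p))"
proof -
  let ?z = "Poly_Mapping.lookup :: (nat \<Rightarrow>\<^sub>0 real) \<Rightarrow> nat \<Rightarrow> real"
  define A where "A z = {m. \<exists>s\<ge>0. \<exists>p\<in>S. \<forall>i\<in>I. ?z z i + s * (g i p - C) \<le> m}" for z
  define q where "q z = Inf (A z)" for z
  define b where "b z = Max ((\<lambda>i. \<bar>?z z i\<bar>) ` I)" for z
  obtain p0 where p0: "p0 \<in> S" using S by blast
  have b: "\<bar>?z z i\<bar> \<le> b z" if "i \<in> I" for z i
    unfolding b_def using I that by (intro Max_ge) auto
  have upper: "m \<in> A z" if "\<And>i. i \<in> I \<Longrightarrow> ?z z i \<le> m" for z m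
    unfolding A_def using that p0 by (auto intro!: exI[of _ 0])
  have memA: "\<exists>s p. s \<ge> 0 \<and> p \<in> S \<and> (\<forall>i\<in>I. ?z z i + s * (g i p - C) \<le> m)"
    if "m \<in> A z" for m z
    using that by (auto simp: A_def)
  have ne: "A z \<noteq> {}" for z
    using upper[of z "b z", OF abs_le_D1[OF b]] by blast
  have lower: "- b z \<le> m" if m: "m \<in> A z" for z m
  proof -
    obtain s p where sp: "s \<ge> 0" "p \<in> S" "\<forall>i\<in>I. ?z z i + s * (g i p - C) \<le> m"
      using memA[OF m] by (elim exE conjE)
    obtain i where i: "i \<in> I" "C \<le> g i p" using ge sp(2) by blast
    have "0 \<le> s * (g i p - C)" using sp(1) i by simp
    then show ?thesis using bspec[OF sp(3) i(1)] b[OF i(1), of z] by linarith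
  qed
  have bdd: "bdd_below (A z)" for z by (rule bdd_belowI[of _ "- b z"]) (rule lower)
  have qle: "q z \<le> m" if "m \<in> A z" for z m
    unfolding q_def using that bdd by (rule cInf_lower)
  have qlt: "\<exists>m\<in>A z. m < y" if "q z < y" for z y
    using that cInf_less_iff[OF ne bdd] unfolding q_def by simp
  have add: "q (x + y) \<le> q x + q y" for x y
  proof (rule field_le_epsilon)
    fix e :: real assume e: "e > 0"
    obtain m1 where m1: "m1 \<in> A x" "m1 < q x + e / 2" using qlt[of x "q x + e / 2"] e by auto
    obtain m2 where m2: "m2 \<in> A y" "m2 < q y + e / 2" using qlt[of y "q y + e / 2"] e by auto
    obtain s p where sp: "s \<ge> 0" "p \<in> S" "\<forall>i\<in>I. ?z x i + s * (g i p - C) \<le> m1"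
      using memA[OF m1(1)] by (elim exE conjE)
    obtain s' p' where sp': "s' \<ge> 0" "p' \<in> S" "\<forall>i\<in>I. ?z y i + s' * (g i p' - C) \<le> m2"
      using memA[OF m2(1)] by (elim exE conjE)
    \<comment> \<open>The convex combination of the two points with weights proportional to \<open>s\<close> and \<open>s'\<close> serves for the sum.\<close>
    have "\<exists>r\<in>S. \<forall>i\<in>I. (s + s') * (g i r - C) \<le> s * (g i p - C) + s' * (g i p' - C)"
    proof (cases "s + s' = 0")
      case True
      then have "s = 0" "s' = 0" using sp sp' by linarith+
      then show ?thesis using p0 by auto
    next
      case False
      then have pos: "s + s' > 0" using sp sp' by linarith
      define u where "u = s / (s + s')"
      have u: "0 \<le> u" "u \<le> 1" "(s + s') * u = s" "(s + s') * (1 - u) = s'"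
        using pos sp sp' by (auto simp: u_def field_simps)
      obtain r where r: "r \<in> S" "\<forall>i\<in>I. g i r \<le> u * g i p + (1 - u) * g i p'"
        using conv[OF sp(2) sp'(2) u(1,2)] by blast
      have "(s + s') * (g i r - C) \<le> s * (g i p - C) + s' * (g i p' - C)" if "i \<in> I" for i
      proof -
        have "(s + s') * g i r \<le> (s + s') * (u * g i p + (1 - u) * g i p')"
          using r that pos by (intro mult_left_mono) auto
        also have "\<dots> = ((s + s') * u) * g i p + ((s + s') * (1 - u)) * g i p'"
          by (simp add: algebra_simps)
        also have "\<dots> = s * g i p + s' * g i p'" using u by simp
        finally show ?thesis by (simp add: algebra_simps)
      qed
      then show ?thesis using r(1) by blast
    qed
    then obtain r where r: "r \<in> S"
        "\<forall>i\<in>I. (s + s') * (g i r - C) \<le> s * (g i p - C) + s' * (g i p' - C)" by blast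
    have "m1 + m2 \<in> A (x + y)"
      unfolding A_def
    proof (intro CollectI exI[of _ "s + s'"] conjI bexI[of _ r] ballI)
      fix i assume "i \<in> I"
      then show "?z (x + y) i + (s + s') * (g i r - C) \<le> m1 + m2"
        using sp(3) sp'(3) r(2) by (fastforce simp: lookup_add)
    qed (use sp sp' r in auto)
    from qle[OF this] show "q (x + y) \<le> q x + q y + e" using m1 m2 by linarith
  qed
  have hom_le: "q (a *\<^sub>R x) \<le> a * q x" if a: "a > 0" for a x
  proof (rule field_le_epsilon)
    fix e :: real assume e: "e > 0"
    obtain m where m: "m \<in> A x" "m < q x + e / a" using qlt[of x "q x + e / a"] e a by auto
    obtain s p where sp: "s \<ge> 0" "p \<in> S" "\<forall>i\<in>I. ?z x i + s * (g i p - C) \<le> m"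
      using memA[OF m(1)] by (elim exE conjE)
    have "a * m \<in> A (a *\<^sub>R x)"
      unfolding A_def
    proof (intro CollectI exI[of _ "a * s"] conjI bexI[of _ p] ballI)
      fix i assume "i \<in> I"
      then have "a * (?z x i + s * (g i p - C)) \<le> a * m" using sp a by simp
      then show "?z (a *\<^sub>R x) i + a * s * (g i p - C) \<le> a * m"
        by (simp add: lookup_scaleR algebra_simps)
    qed (use sp a in auto)
    from qle[OF this] have "q (a *\<^sub>R x) \<le> a * m" .
    also have "\<dots> \<le> a * (q x + e / a)" using m(2) a by simp
    finally show "q (a *\<^sub>R x) \<le> a * q x + e" using a by (simp add: distrib_left)
  qed
  have hom: "q (a *\<^sub>R x) = a * q x" if a: "a > 0" for a x
  proof (rule antisym[OF hom_le[OF a]])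
    have "q ((1 / a) *\<^sub>R (a *\<^sub>R x)) \<le> (1 / a) * q (a *\<^sub>R x)" using a by (intro hom_le) simp
    then show "a * q x \<le> q (a *\<^sub>R x)" using a by (simp add: field_simps)
  qed
  define B where "B = (\<lambda>i. Poly_Mapping.single i (1::real)) ` I"
  have B: "finite B" using I by (simp add: B_def)
  have "q 0 = 0"
    using hom[of 2 0] by simp
  then have "\<exists>l. linear l \<and> (\<forall>u\<in>span {}. l u = 0) \<and> (\<forall>u\<in>span ({} \<union> B). l u \<le> q u)"
    by (intro hahn_banach_finite[OF B, of "{}" q "\<lambda>_. 0"])
       (auto simp: sublinear_on_def add hom linear_zero)
  then obtain l where l: "linear l" and lq: "\<And>u. u \<in> span B \<Longrightarrow> l u \<le> q u" by auto
  define w where "w i = l (Poly_Mapping.single i 1)" for i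
  define vec where "vec y = (\<Sum>i\<in>I. y i *\<^sub>R Poly_Mapping.single i (1::real))" for y :: "nat \<Rightarrow> real"
  have vecB: "vec y \<in> span B" for y
    unfolding vec_def B_def by (intro span_sum span_scale span_base) auto
  have lvec: "l (vec y) = (\<Sum>i\<in>I. y i * w i)" for y
    unfolding vec_def w_def using l by (simp add: linear_sum linear_scale)
  have zvec: "?z (vec y) i = y i" if "i \<in> I" for y i
    unfolding vec_def using that I
    by (simp add: lookup_sum lookup_scaleR lookup_single when_def if_distrib cong: if_cong)
  have bound: "(\<Sum>i\<in>I. y i * w i) \<le> m" if "\<And>i. i \<in> I \<Longrightarrow> y i \<le> m" for y m
    using lq[OF vecB[of y]] qle[OF upper[of "vec y" m]] that by (simp add: lvec zvec)
  have w0: "0 \<le> w i" if "i \<in> I" for i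
    using bound[of "\<lambda>j. if j = i then -1 else 0" 0] that I
    by (simp add: if_distrib[of "\<lambda>x. x * _"] sum_negf cong: if_cong)
  have w1: "sum w I = 1"
    using bound[of "\<lambda>_. 1" 1] bound[of "\<lambda>_. -1" "-1"] by (simp add: sum_negf)
  have "C \<le> (\<Sum>i\<in>I. w i * g i p)" if p: "p \<in> S" for p
  proof -
    let ?y = "\<lambda>i. C - g i p"
    have "0 \<in> A (vec ?y)"
      unfolding A_def using p by (auto simp: zvec intro!: exI[of _ 1] bexI[of _ p])
    then have "(\<Sum>i\<in>I. ?y i * w i) \<le> 0"
      using lq[OF vecB[of ?y]] qle[of 0 "vec ?y"] by (simp add: lvec)
    moreover have "(\<Sum>i\<in>I. ?y i * w i) = C * sum w I - (\<Sum>i\<in>I. w i * g i p)"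
      by (simp add: algebra_simps sum_subtractf sum_distrib_left)
    ultimately show ?thesis using w1 by simp
  qed
  then show ?thesis using w0 w1 by blast
qed

text \<open>Some weights of \<open>minimax_weights\<close> may vanish. Mixing them with a little of the uniform distribution
  makes them positive and keeps the averages above \<open>c\<close>, because the functions are nonnegative.\<close>

lemma finite_minimax:
  fixes g :: "nat \<Rightarrow> 'a \<Rightarrow> real" and I :: "nat set"
  assumes I: "finite I" "I \<noteq> {}"
    and conv: "\<And>p q u. p \<in> S \<Longrightarrow> q \<in> S \<Longrightarrow> 0 \<le> u \<Longrightarrow> u \<le> 1 \<Longrightarrow>
                 \<exists>r\<in>S. \<forall>i\<in>I. g i r \<le> u * g i p + (1 - u) * g i q"
    and g0: "\<And>i p. 0 \<le> g i p"
    and avg: "\<And>w. (\<And>i. i \<in> I \<Longrightarrow> 0 < w i) \<Longrightarrow> sum w I = 1 \<Longrightarrow>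
                \<exists>p\<in>S. (\<Sum>i\<in>I. w i * g i p) \<le> c"
    and C: "c < C"
  shows "\<exists>p\<in>S. \<forall>i\<in>I. g i p < C"
proof (rule ccontr)
  assume "\<not> (\<exists>p\<in>S. \<forall>i\<in>I. g i p < C)"
  then have ge: "\<And>p. p \<in> S \<Longrightarrow> \<exists>i\<in>I. C \<le> g i p" by (meson not_less)
  define N where "N = real (card I)"
  have N: "N > 0" using I by (simp add: N_def card_gt_0_iff)
  obtain p1 where p1: "p1 \<in> S" "(\<Sum>i\<in>I. 1 / N * g i p1) \<le> c"
    using avg[of "\<lambda>_. 1 / N"] N by (auto simp: N_def)
  have c0: "0 \<le> c"
    using p1(2) N g0 sum_nonneg[of I "\<lambda>i. 1 / N * g i p1"] by fastforce
  have "\<exists>w. (\<forall>i\<in>I. 0 \<le> w i) \<and> sum w I = 1 \<and> (\<forall>p\<in>S. C \<le> (\<Sum>i\<in>I. w i * g i p))"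
    using p1(1) by (intro minimax_weights[OF I _ conv ge]) auto
  then obtain w where w: "\<And>i. i \<in> I \<Longrightarrow> 0 \<le> w i" "sum w I = 1"
      "\<And>p. p \<in> S \<Longrightarrow> C \<le> (\<Sum>i\<in>I. w i * g i p)" by blast
  \<comment> \<open>The share of the uniform distribution: small enough that \<open>(1 - h) C\<close> still exceeds \<open>c\<close>.\<close>
  define h where "h = (C - c) / (2 * C)"
  have h: "0 < h" "h < 1" "c < (1 - h) * C"
    using C c0 by (auto simp: h_def field_simps)
  define w' where "w' i = (1 - h) * w i + h / N" for i
  have "sum w' I = (1 - h) * sum w I + real (card I) * (h / N)"
    by (simp add: w'_def sum.distrib sum_distrib_left)
  then have "sum w' I = 1" using w(2) N by (simp add: N_def)
  moreover have "0 < w' i" if "i \<in> I" for i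
    using w(1)[OF that] h N by (simp add: w'_def add_nonneg_pos)
  ultimately obtain p where p: "p \<in> S" "(\<Sum>i\<in>I. w' i * g i p) \<le> c" using avg by blast
  have "(1 - h) * C \<le> (1 - h) * (\<Sum>i\<in>I. w i * g i p)"
    using w(3)[OF p(1)] h by simp
  also have "\<dots> = (\<Sum>i\<in>I. (1 - h) * w i * g i p)" by (simp add: sum_distrib_left mult.assoc)
  also have "\<dots> \<le> (\<Sum>i\<in>I. w' i * g i p)"
    using h N g0 by (intro sum_mono mult_right_mono) (auto simp: w'_def)
  finally show False using p(2) h(3) by linarith
qed

section \<open>Orthonormal bases for a positive definite form\<close>

text \<open>The form is positive definite only on the span of \<open>B\<close>: it will be a weighted sum over finitely
  many coordinates of a sequence.\<close>

lemma gram_schmidt_form: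
  fixes ip :: "'a::real_vector \<Rightarrow> 'a \<Rightarrow> real"
  assumes lin: "\<And>y. linear (\<lambda>x. ip x y)" and sym: "\<And>x y. ip x y = ip y x"
    and "finite B" "independent B" and "\<And>x. x \<in> span B \<Longrightarrow> x \<noteq> 0 \<Longrightarrow> 0 < ip x x"
  shows "\<exists>c. (\<forall>k<card B. c k \<in> span B) \<and>
             (\<forall>k<card B. \<forall>l<card B. ip (c k) (c l) = (if k = l then 1 else 0)) \<and>
             (\<forall>x\<in>span B. x = (\<Sum>k<card B. ip x (c k) *\<^sub>R c k))"
  using assms(3-5)
proof (induction B)
  case empty
  then show ?case by simp
next
  case (insert b B)
  let ?m = "card B" and ?V = "span (insert b B)"
  have sub: "span B \<subseteq> ?V" by (rule span_mono) auto
  have bB: "b \<notin> span B" "independent B"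
    using insert.prems(1) insert.hyps(2) by (simp_all add: independent_insert)
  have posB: "0 < ip x x" if "x \<in> span B" "x \<noteq> 0" for x
    using insert.prems(2) that sub by blast
  obtain c where c: "\<And>k. k < ?m \<Longrightarrow> c k \<in> span B"
      "\<And>k l. k < ?m \<Longrightarrow> l < ?m \<Longrightarrow> ip (c k) (c l) = (if k = l then 1 else 0)"
      "\<And>x. x \<in> span B \<Longrightarrow> x = (\<Sum>k<?m. ip x (c k) *\<^sub>R c k)"
    using insert.IH[OF bB(2) posB] by blast
  define pb where "pb = (\<Sum>k<?m. ip b (c k) *\<^sub>R c k)"
  define y where "y = b - pb"
  have pb: "pb \<in> span B" unfolding pb_def by (intro span_sum span_scale c) auto
  have yV: "y \<in> ?V" unfolding y_def using pb sub by (intro span_diff) (auto intro: span_base)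
  have "y \<noteq> 0" using pb bB(1) by (auto simp: y_def)
  then have yy: "ip y y > 0" using insert.prems(2) yV by blast
  note lins = linear_add[OF lin] linear_diff[OF lin] linear_scale[OF lin] linear_sum[OF lin]
  have lins2: "ip x (u + v) = ip x u + ip x v" "ip x (a *\<^sub>R u) = a * ip x u"
    "ip x (\<Sum>k\<in>J. f k) = (\<Sum>k\<in>J. ip x (f k))" for x u v a J and f :: "nat \<Rightarrow> 'a"
    using lins by (simp_all add: sym[of x])
  have yc: "ip y (c l) = 0" if "l < ?m" for l
  proof -
    have "ip pb (c l) = (\<Sum>k<?m. ip b (c k) * ip (c k) (c l))"
      unfolding pb_def by (simp add: lins)
    also have "\<dots> = (\<Sum>k<?m. if k = l then ip b (c k) else 0)"
      by (rule sum.cong) (use c(2) that in auto)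
    also have "\<dots> = ip b (c l)" using that by simp
    finally show ?thesis by (simp add: y_def lins)
  qed
  have yB: "ip x y = 0" if "x \<in> span B" for x
  proof -
    have "ip x y = ip y (\<Sum>k<?m. ip x (c k) *\<^sub>R c k)" using c(3)[OF that] sym by simp
    also have "\<dots> = 0" by (simp add: lins2 yc)
    finally show ?thesis .
  qed
  define s where "s = sqrt (ip y y)"
  have s: "s > 0" "s * s = ip y y" using yy by (auto simp: s_def)
  define c' where "c' = c(?m := (1 / s) *\<^sub>R y)"
  have c'[simp]: "c' ?m = (1 / s) *\<^sub>R y" "\<And>k. k < ?m \<Longrightarrow> c' k = c k"
    by (auto simp: c'_def)
  define R where "R x = (\<Sum>k<Suc ?m. ip x (c' k) *\<^sub>R c' k)" for x
  have linR: "linear R"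
    unfolding R_def
    by (rule linearI) (simp_all add: lins scaleR_left_distrib sum.distrib scaleR_sum_right algebra_simps)
  have Rm: "R x = (\<Sum>k<?m. ip x (c k) *\<^sub>R c k) + (ip x y / ip y y) *\<^sub>R y" for x
    unfolding R_def using s by (simp add: lins2 s(2)[symmetric])
  have "R x = id x" if "x \<in> insert b B" for x
  proof (cases "x = b")
    case True
    have "ip b y = ip y y + ip pb y" by (simp add: y_def lins)
    then have "ip b y = ip y y" using yB[OF pb] by simp
    then have "R b = pb + y" using yy by (simp add: Rm pb_def)
    then show ?thesis using True by (simp add: y_def)
  next
    case False
    then have xB: "x \<in> span B" using that by (simp add: span_base)
    show ?thesis using c(3)[OF xB] yB[OF xB] by (simp add: Rm)
  qed
  then have Rid: "R x = x" if "x \<in> ?V" for x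
    using linear_eq_on_span[OF linR linear_id, of "insert b B" x] that by simp
  have "ip y y = s * s" by (simp add: s(2))
  then have "\<forall>k<Suc ?m. \<forall>l<Suc ?m. ip (c' k) (c' l) = (if k = l then 1 else 0)"
    using c(2) yc yc[unfolded sym[of y]] s(1)
    by (auto simp: less_Suc_eq lins lins2)
  moreover have "\<forall>k<Suc ?m. c' k \<in> ?V"
    using c(1) sub yV by (auto simp: less_Suc_eq intro: span_scale)
  ultimately show ?case
    using insert.hyps Rid unfolding R_def by (intro exI[of _ c']) auto
qed

section \<open>The extremal value\<close>

text \<open>For orthonormal \<open>v\<^sub>0, \<dots>, v\<^sub>n\<^sub>-\<^sub>1\<close> this is the matrix of the orthogonal projection onto their span.\<close>

definition gram_kernel :: "nat \<Rightarrow> (nat \<Rightarrow> nat \<Rightarrow> real) \<Rightarrow> nat \<Rightarrow> nat \<Rightarrow> real" where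
  "gram_kernel n v i j = (\<Sum>k<n. v k i * v k j)"

definition orthonormal_on :: "nat set \<Rightarrow> nat \<Rightarrow> (nat \<Rightarrow> nat \<Rightarrow> real) \<Rightarrow> bool" where
  "orthonormal_on I n v \<longleftrightarrow>
     (\<forall>k<n. \<forall>l<n. (\<Sum>i\<in>I. v k i * v l i) = (if k = l then 1 else 0))"

definition unit_weight :: "nat set \<Rightarrow> (nat \<Rightarrow> real) \<Rightarrow> bool" where
  "unit_weight I t \<longleftrightarrow> (\<forall>i\<in>I. 0 \<le> t i) \<and> (\<Sum>i\<in>I. (t i)\<^sup>2) = 1"

definition weighted_kernel_sum :: "nat set \<Rightarrow> nat \<Rightarrow> (nat \<Rightarrow> real) \<Rightarrow> (nat \<Rightarrow> nat \<Rightarrow> real) \<Rightarrow> real" where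
  "weighted_kernel_sum I n t v = (\<Sum>i\<in>I. \<Sum>j\<in>I. t i * t j * \<bar>gram_kernel n v i j\<bar>)"

text \<open>By a theorem of Chalmers and Lewicki this number equals \<open>\<Pi>\<^sub>n\<close>.\<close>

definition extremal_value :: "nat \<Rightarrow> real" where
  "extremal_value n = Sup {weighted_kernel_sum I n t v | I t v. finite I \<and> unit_weight I t \<and> orthonormal_on I n v}"

text \<open>By the triangle inequality for \<open>\<bar>\<Sum>\<^sub>k v\<^sub>k(i) v\<^sub>k(j)\<bar>\<close> the double sum is at most
  \<open>\<Sum>\<^sub>k (\<Sum>\<^sub>i t\<^sub>i \<bar>v\<^sub>k(i)\<bar>)\<^sup>2\<close>, and each square is at most \<open>1\<close> by Cauchy--Schwarz.\<close>

lemma weighted_kernel_sum_le: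
  assumes I: "finite I" and t: "unit_weight I t" and v: "orthonormal_on I n v"
  shows "weighted_kernel_sum I n t v \<le> n"
proof -
  have "weighted_kernel_sum I n t v \<le> (\<Sum>i\<in>I. \<Sum>j\<in>I. t i * t j * (\<Sum>k<n. \<bar>v k i\<bar> * \<bar>v k j\<bar>))"
    unfolding weighted_kernel_sum_def
  proof (intro sum_mono mult_left_mono)
    fix i j assume "i \<in> I" "j \<in> I"
    then show "0 \<le> t i * t j" using t by (simp add: unit_weight_def)
    show "\<bar>gram_kernel n v i j\<bar> \<le> (\<Sum>k<n. \<bar>v k i\<bar> * \<bar>v k j\<bar>)"
      unfolding gram_kernel_def abs_mult[symmetric] by (rule sum_abs)
  qed
  also have "\<dots> = (\<Sum>i\<in>I. \<Sum>j\<in>I. \<Sum>k<n. (t i * \<bar>v k i\<bar>) * (t j * \<bar>v k j\<bar>))"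
    by (simp add: sum_distrib_left mult_ac)
  also have "\<dots> = (\<Sum>i\<in>I. \<Sum>k<n. \<Sum>j\<in>I. (t i * \<bar>v k i\<bar>) * (t j * \<bar>v k j\<bar>))"
    by (intro sum.cong refl sum.swap)
  also have "\<dots> = (\<Sum>k<n. \<Sum>i\<in>I. \<Sum>j\<in>I. (t i * \<bar>v k i\<bar>) * (t j * \<bar>v k j\<bar>))"
    by (rule sum.swap)
  also have "\<dots> = (\<Sum>k<n. (\<Sum>i\<in>I. t i * \<bar>v k i\<bar>)\<^sup>2)"
    by (simp add: power2_eq_square sum_product)
  also have "\<dots> \<le> (\<Sum>k<n. 1)"
  proof (rule sum_mono)
    fix k assume "k \<in> {..<n}"
    then have "(\<Sum>i\<in>I. \<bar>v k i\<bar>\<^sup>2) = 1" using v by (simp add: orthonormal_on_def power2_eq_square)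
    then show "(\<Sum>i\<in>I. t i * \<bar>v k i\<bar>)\<^sup>2 \<le> 1"
      using Cauchy_Schwarz_ineq_sum[of t "\<lambda>i. \<bar>v k i\<bar>" I] t by (simp add: unit_weight_def)
  qed
  finally show ?thesis by simp
qed

lemma bdd_above_weighted_kernel_sum:
  "bdd_above {weighted_kernel_sum I n t v | I t v. finite I \<and> unit_weight I t \<and> orthonormal_on I n v}"
  by (rule bdd_aboveI[of _ "real n"]) (auto intro: weighted_kernel_sum_le)

section \<open>Finitely many coordinates almost norm a finite-dimensional subspace\<close>

lemma apply_bcontfun_sum:
  "apply_bcontfun (\<Sum>k\<in>A. f k) i = (\<Sum>k\<in>A. apply_bcontfun (f k) i)"
  for f :: "'c \<Rightarrow> ('a::topological_space \<Rightarrow>\<^sub>C 'b::real_normed_vector)"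
  by (induction A rule: infinite_finite_induct) auto

text \<open>Rounding \<open>(c\<^sub>1(k), \<dots>, c\<^sub>n(k))\<close> to multiples of \<open>d\<close> leaves finitely many values; one
  index \<open>k\<close> is kept for each of them.\<close>

lemma finite_coordinate_net:
  fixes c :: "nat \<Rightarrow> linfty"
  assumes d: "d > 0"
  shows "\<exists>I. finite I \<and> I \<noteq> {} \<and> (\<forall>k. \<exists>i\<in>I. \<forall>m<n. \<bar>c m k - c m i\<bar> \<le> d)"
proof -
  define h where "h k = restrict (\<lambda>m. \<lfloor>c m k / d\<rfloor>) {..<n}" for k
  have hb: "\<lfloor>- (norm (c m) / d)\<rfloor> \<le> \<lfloor>c m k / d\<rfloor> \<and> \<lfloor>c m k / d\<rfloor> \<le> \<lfloor>norm (c m) / d\<rfloor>" for m k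
    using norm_bounded[of "c m" k] d
    by (intro conjI floor_mono) (auto simp: divide_right_mono abs_le_iff field_simps)
  have "range h \<subseteq> (\<Pi>\<^sub>E m\<in>{..<n}. {\<lfloor>- (norm (c m) / d)\<rfloor>..\<lfloor>norm (c m) / d\<rfloor>})"
    using hb by (intro image_subsetI PiE_I) (auto simp: h_def)
  moreover have "finite (\<Pi>\<^sub>E m\<in>{..<n}. {\<lfloor>- (norm (c m) / d)\<rfloor>..\<lfloor>norm (c m) / d\<rfloor>})"
    by (intro finite_PiE) auto
  ultimately have fin: "finite (range h)" by (rule finite_subset)
  define I where "I = inv h ` range h"
  have "\<exists>i\<in>I. \<forall>m<n. \<bar>c m k - c m i\<bar> \<le> d" for k
  proof (intro bexI allI impI)
    show "inv h (h k) \<in> I" by (simp add: I_def)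
    fix m assume m: "m < n"
    have "h (inv h (h k)) = h k" by (simp add: f_inv_into_f)
    from fun_cong[OF this, of m] m
    have "\<lfloor>c m (inv h (h k)) / d\<rfloor> = \<lfloor>c m k / d\<rfloor>" by (simp add: h_def)
    then have "\<bar>c m k / d - c m (inv h (h k)) / d\<bar> \<le> 1" by linarith
    then show "\<bar>c m k - c m (inv h (h k))\<bar> \<le> d"
      using d by (simp add: diff_divide_distrib[symmetric])
  qed
  then show ?thesis using fin by (intro exI[of _ I]) (auto simp: I_def)
qed

text \<open>The form \<open>\<Sum>\<^sub>i 2\<^sup>-\<^sup>i x\<^sub>i y\<^sub>i\<close> is positive definite on all of \<open>\<ell>\<^sub>\<infinity>\<close>. Expanding in an
  orthonormal basis for it bounds the coefficients of \<open>x\<close> by a multiple of its supremum norm, which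
  reduces the claim to the finitely many basis vectors.\<close>

lemma finite_norming_coordinates:
  fixes B :: "linfty set"
  assumes B: "finite B" "independent B" and e: "e > 0"
  shows "\<exists>I. finite I \<and> I \<noteq> {} \<and> (\<forall>k. \<exists>i\<in>I. \<forall>x\<in>span B. \<bar>apply_bcontfun x k - apply_bcontfun x i\<bar> \<le> e * norm x)"
proof -
  have geo: "summable (\<lambda>i. (1/2::real) ^ i)" "suminf (\<lambda>i. (1/2::real) ^ i) = 2"
    using geometric_sums[of "1/2::real"] by (auto simp: sums_iff)
  have trm: "\<bar>(1/2) ^ i * (x i * y i)\<bar> \<le> (1/2) ^ i * (norm x * norm y)" for x y :: linfty and i
    using norm_bounded[of x i] norm_bounded[of y i]
    by (simp add: abs_mult mult_mono)
  have sm: "summable (\<lambda>i. \<bar>(1/2) ^ i * (x i * y i)\<bar>)" for x y :: linfty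
    using trm by (intro summable_comparison_test'[OF summable_mult2[OF geo(1), of "norm x * norm y"], of 0]) simp
  have sm': "summable (\<lambda>i. (1/2) ^ i * (x i * y i))" for x y :: linfty
    using sm by (rule summable_rabs_cancel)
  define ip where "ip x y = suminf (\<lambda>i. (1/2) ^ i * (x i * y i))" for x y :: linfty
  have ipb: "\<bar>ip x y\<bar> \<le> 2 * (norm x * norm y)" for x y
  proof -
    have "\<bar>ip x y\<bar> \<le> suminf (\<lambda>i. \<bar>(1/2) ^ i * (x i * y i)\<bar>)"
      unfolding ip_def by (rule summable_rabs[OF sm])
    also have "\<dots> \<le> suminf (\<lambda>i. (1/2) ^ i * (norm x * norm y))"
      by (rule suminf_le[OF trm sm summable_mult2[OF geo(1)]])
    also have "\<dots> = 2 * (norm x * norm y)"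
      by (subst suminf_mult2[OF geo(1), symmetric]) (simp add: geo)
    finally show ?thesis .
  qed
  have lin: "linear (\<lambda>x. ip x y)" for y
  proof (rule linearI)
    show "ip (x + x') y = ip x y + ip x' y" for x x'
      unfolding ip_def suminf_add[OF sm' sm'] by (simp add: algebra_simps)
    show "ip (a *\<^sub>R x) y = a *\<^sub>R ip x y" for a x
      unfolding ip_def using suminf_mult[OF sm', of a x y] by (simp add: algebra_simps)
  qed
  have sym: "ip x y = ip y x" for x y by (simp add: ip_def mult.commute)
  have pos: "0 < ip x x" if nz: "x \<noteq> 0" for x
  proof -
    obtain i where i: "x i \<noteq> 0" using nz bcontfun_eqI[of x 0] by auto
    show ?thesis
      unfolding ip_def by (rule suminf_pos2[OF sm', where i = i]) (use i in \<open>auto simp: zero_less_mult_iff linorder_neq_iff\<close>)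
  qed
  let ?n = "card B"
  obtain c where c: "\<And>x. x \<in> span B \<Longrightarrow> x = (\<Sum>k<?n. ip x (c k) *\<^sub>R c k)"
    using gram_schmidt_form[of ip, OF lin sym B pos] by blast
  define M where "M = (\<Sum>k<?n. norm (c k))"
  have M0: "M \<ge> 0" by (simp add: M_def sum_nonneg)
  define d where "d = e / (2 * (M + 1))"
  have d: "d > 0" "2 * M * d \<le> e" using e M0 by (auto simp: d_def field_simps)
  obtain I where I: "finite I" "I \<noteq> {}" "\<forall>k. \<exists>i\<in>I. \<forall>m<?n. \<bar>c m k - c m i\<bar> \<le> d"
    using finite_coordinate_net[OF d(1), of ?n c] by blast
  have "\<bar>x k - x i\<bar> \<le> e * norm x"
    if x: "x \<in> span B" and i: "\<forall>m<?n. \<bar>c m k - c m i\<bar> \<le> d" for x :: linfty and k i :: nat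
  proof -
    have xk: "x k = (\<Sum>m<?n. ip x (c m) * c m k)" for k
      using arg_cong[OF c[OF x], of "\<lambda>f. apply_bcontfun f k"] by (simp add: apply_bcontfun_sum)
    have "\<bar>x k - x i\<bar> = \<bar>\<Sum>m<?n. ip x (c m) * (c m k - c m i)\<bar>"
      by (simp add: xk right_diff_distrib sum_subtractf)
    also have "\<dots> \<le> (\<Sum>m<?n. \<bar>ip x (c m) * (c m k - c m i)\<bar>)" by (rule sum_abs)
    also have "\<dots> \<le> (\<Sum>m<?n. 2 * (norm x * norm (c m)) * d)"
      unfolding abs_mult using i d by (intro sum_mono mult_mono ipb) auto
    also have "\<dots> = norm x * (2 * M * d)"
      by (simp add: M_def sum_distrib_left sum_distrib_right mult_ac)
    also have "\<dots> \<le> norm x * e" using d by (intro mult_left_mono) auto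
    finally show ?thesis by (simp add: mult.commute)
  qed
  then show ?thesis using I by (intro exI[of _ I]) meson
qed

section \<open>Projections onto finite-dimensional subspaces of \<open>\<ell>\<^sub>\<infinity>\<close>\<close>

text \<open>The projection \<open>x \<mapsto> \<Sum>\<^sub>j x\<^sub>j p\<^sub>j\<close> is orthogonal for the form \<open>\<Sum>\<^sub>i w\<^sub>i x\<^sub>i y\<^sub>i\<close>. If
  \<open>c\<^sub>k\<close> is an orthonormal basis for this form, then \<open>v\<^sub>k(i) = \<surd>w\<^sub>i c\<^sub>k(i)\<close> is orthonormal in the
  usual sense, the entry of the projection in row \<open>i\<close> and column \<open>j\<close> is
  \<open>\<surd>w\<^sub>j K\<^sub>i\<^sub>j / \<surd>w\<^sub>i\<close> with \<open>K\<close> the kernel of \<open>v\<close>, and the factor \<open>w\<^sub>i\<close> turns this into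
  the summand \<open>\<surd>w\<^sub>i \<surd>w\<^sub>j \<bar>K\<^sub>i\<^sub>j\<bar>\<close>.\<close>

lemma weighted_orthogonal_projection:
  fixes B :: "linfty set" and w :: "nat \<Rightarrow> real"
  assumes B: "finite B" "independent B" and I: "finite I"
    and inj: "\<And>x. x \<in> span B \<Longrightarrow> (\<And>i. i \<in> I \<Longrightarrow> apply_bcontfun x i = 0) \<Longrightarrow> x = 0"
    and w: "\<And>i. i \<in> I \<Longrightarrow> 0 < w i" "sum w I = 1"
    and L: "\<And>t v. unit_weight I t \<Longrightarrow> orthonormal_on I (card B) v \<Longrightarrow> weighted_kernel_sum I (card B) t v \<le> L"
  shows "\<exists>p :: nat \<Rightarrow> linfty. (\<forall>j. p j \<in> span B) \<and>
           (\<forall>x\<in>span B. (\<Sum>j\<in>I. apply_bcontfun x j *\<^sub>R p j) = x) \<and>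
           (\<Sum>i\<in>I. w i * (\<Sum>j\<in>I. \<bar>apply_bcontfun (p j) i\<bar>)) \<le> L"
proof -
  let ?n = "card B"
  define ip where "ip x y = (\<Sum>i\<in>I. w i * (apply_bcontfun x i * apply_bcontfun y i))" for x y :: linfty
  have lin: "linear (\<lambda>x. ip x y)" for y
    by (rule linearI) (simp_all add: ip_def algebra_simps sum.distrib sum_distrib_left)
  have sym: "ip x y = ip y x" for x y by (simp add: ip_def mult.commute)
  have pos: "0 < ip x x" if x: "x \<in> span B" "x \<noteq> 0" for x
  proof -
    obtain i where i: "i \<in> I" "apply_bcontfun x i \<noteq> 0" using inj[OF x(1)] x(2) by blast
    have "0 < w i * (apply_bcontfun x i * apply_bcontfun x i)"
      using w(1)[OF i(1)] i(2) by (auto simp: zero_less_mult_iff linorder_neq_iff)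
    moreover have "0 \<le> w j * (apply_bcontfun x j * apply_bcontfun x j)" if "j \<in> I" for j
      using w(1)[OF that] by simp
    ultimately show ?thesis unfolding ip_def using i(1) I by (intro sum_pos2[of I i]) auto
  qed
  obtain c where c: "\<And>k. k < ?n \<Longrightarrow> c k \<in> span B"
      "\<And>k l. k < ?n \<Longrightarrow> l < ?n \<Longrightarrow> ip (c k) (c l) = (if k = l then 1 else 0)"
      "\<And>x. x \<in> span B \<Longrightarrow> x = (\<Sum>k<?n. ip x (c k) *\<^sub>R c k)"
    using gram_schmidt_form[of ip, OF lin sym B pos] by blast
  define p where "p j = (\<Sum>k<?n. (w j * apply_bcontfun (c k) j) *\<^sub>R c k)" for j
  define v where "v k i = sqrt (w i) * apply_bcontfun (c k) i" for k i
  define t where "t i = sqrt (w i)" for i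
  have ws: "sqrt (w i) * sqrt (w i) = w i" if "i \<in> I" for i
    using w(1)[OF that] by simp
  have "unit_weight I t"
    using w ws by (auto simp: unit_weight_def t_def power2_eq_square intro: less_imp_le cong: sum.cong)
  moreover have "orthonormal_on I ?n v"
    unfolding orthonormal_on_def
  proof (intro allI impI)
    fix k l assume "k < ?n" "l < ?n"
    then have "ip (c k) (c l) = (if k = l then 1 else 0)" by (rule c(2))
    moreover have "(\<Sum>i\<in>I. v k i * v l i) = ip (c k) (c l)"
      unfolding ip_def
    proof (rule sum.cong)
      fix i assume i: "i \<in> I"
      have "v k i * v l i = (sqrt (w i) * sqrt (w i)) * (apply_bcontfun (c k) i * apply_bcontfun (c l) i)"
        unfolding v_def by (simp only: mult_ac)
      then show "v k i * v l i = w i * (apply_bcontfun (c k) i * apply_bcontfun (c l) i)"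
        by (simp only: ws[OF i])
    qed simp
    ultimately show "(\<Sum>i\<in>I. v k i * v l i) = (if k = l then 1 else 0)" by simp
  qed
  ultimately have "weighted_kernel_sum I ?n t v \<le> L" by (rule L)
  moreover have "(\<Sum>i\<in>I. w i * (\<Sum>j\<in>I. \<bar>apply_bcontfun (p j) i\<bar>)) = weighted_kernel_sum I ?n t v"
  proof -
    have "w i * \<bar>apply_bcontfun (p j) i\<bar> = t i * t j * \<bar>gram_kernel ?n v i j\<bar>"
      if ij: "i \<in> I" "j \<in> I" for i j
    proof -
      let ?s = "\<Sum>k<?n. apply_bcontfun (c k) j * apply_bcontfun (c k) i"
      have "apply_bcontfun (p j) i = w j * ?s"
        by (simp add: p_def apply_bcontfun_sum sum_distrib_left mult_ac)
      then have "w i * \<bar>apply_bcontfun (p j) i\<bar> = w i * w j * \<bar>?s\<bar>"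
        using w(1)[OF ij(2)] by (simp add: abs_mult)
      moreover have "gram_kernel ?n v i j = t i * t j * ?s"
        by (simp add: gram_kernel_def v_def t_def sum_distrib_left mult_ac)
      moreover have "t i \<ge> 0" "t j \<ge> 0" using w(1)[OF ij(1)] w(1)[OF ij(2)] by (simp_all add: t_def)
      moreover have "w i * w j = t i * t j * (t i * t j)"
        using ws[OF ij(1)] ws[OF ij(2)] by (metis t_def mult.commute mult.left_commute)
      ultimately show ?thesis by (simp add: abs_mult)
    qed
    then show ?thesis
      unfolding weighted_kernel_sum_def sum_distrib_left by (intro sum.cong refl) auto
  qed
  moreover have "p j \<in> span B" for j
    unfolding p_def by (intro span_sum span_scale c) auto
  moreover have "(\<Sum>j\<in>I. apply_bcontfun x j *\<^sub>R p j) = x" if "x \<in> span B" for x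
  proof -
    have "(\<Sum>j\<in>I. apply_bcontfun x j *\<^sub>R p j)
        = (\<Sum>j\<in>I. \<Sum>k<?n. (w j * (apply_bcontfun x j * apply_bcontfun (c k) j)) *\<^sub>R c k)"
      by (simp add: p_def scaleR_sum_right mult_ac)
    also have "\<dots> = (\<Sum>k<?n. ip x (c k) *\<^sub>R c k)"
      unfolding ip_def scaleR_sum_left by (rule sum.swap)
    finally show ?thesis using c(3)[OF that] by simp
  qed
  ultimately show ?thesis by (intro exI[of _ p]) auto
qed

lemma bounded_projection_bdd_above:
  assumes P: "bounded_projection E F P"
  shows "bdd_above ((\<lambda>x. norm (P x) / norm x) ` F)"
proof -
  obtain b where b: "\<forall>x\<in>F. norm (P x) \<le> b * norm x"
    using P unfolding bounded_projection_def by blast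
  have "norm (P x) / norm x \<le> max b 0" if "x \<in> F" for x
  proof -
    have "norm (P x) \<le> b * norm x" using b that by blast
    also have "\<dots> \<le> max b 0 * norm x" by (intro mult_right_mono) auto
    finally show ?thesis by (cases "norm x = 0") (auto simp: divide_le_eq)
  qed
  then show ?thesis by (rule bdd_aboveI2)
qed

lemma op_norm_on_nonneg:
  assumes P: "bounded_projection E F P" and F: "0 \<in> F"
  shows "0 \<le> op_norm_on F P"
  using cSUP_upper[OF F bounded_projection_bdd_above[OF P]] by (simp add: op_norm_on_def)

lemma norm_le_op_norm_on:
  assumes P: "bounded_projection E F P" and x: "x \<in> F"
  shows "norm (P x) \<le> op_norm_on F P * norm x"
proof (cases "norm x = 0")
  case True
  then show ?thesis using P x unfolding bounded_projection_def by auto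
next
  case False
  have "norm (P x) / norm x \<le> op_norm_on F P"
    unfolding op_norm_on_def by (rule cSUP_upper[OF x bounded_projection_bdd_above[OF P]])
  then show ?thesis using False by (simp add: divide_le_eq)
qed

lemma rel_proj_const_le:
  assumes P: "bounded_projection E F P" and F: "0 \<in> F"
    and C: "0 \<le> C" "\<And>x. x \<in> F \<Longrightarrow> norm (P x) \<le> C * norm x"
  shows "op_norm_on F P \<le> C" "rel_proj_const E F \<le> C"
proof -
  have le: "norm (P x) / norm x \<le> C" if "x \<in> F" for x
    using C(2)[OF that] C(1) by (cases "norm x = 0") (auto simp: divide_le_eq)
  then show 1: "op_norm_on F P \<le> C"
    unfolding op_norm_on_def using F by (intro cSUP_least) auto
  have "bdd_below {op_norm_on F P |P. bounded_projection E F P}"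
    using op_norm_on_nonneg F by (intro bdd_belowI[of _ 0]) auto
  then have "rel_proj_const E F \<le> op_norm_on F P"
    unfolding rel_proj_const_def using P by (intro cInf_lower) auto
  with 1 show "rel_proj_const E F \<le> C" by linarith
qed

text \<open>On coordinates \<open>I\<close> that norm the subspace up to a factor \<open>1 - e\<close>, the minimax inequality applied
  to the row norms of the projections \<open>x \<mapsto> \<Sum>\<^sub>j\<^sub>\<in>\<^sub>I x\<^sub>j p\<^sub>j\<close> gives one whose rows in \<open>I\<close> have norm below
  \<open>L + d\<close>; its operator norm is then at most \<open>(L + d) / (1 - e)\<close>.\<close>

lemma rel_proj_const_in_linfty_le:
  fixes B :: "linfty set"
  assumes B: "finite B" "independent B"
    and L: "\<And>I t v. finite I \<Longrightarrow> unit_weight I t \<Longrightarrow> orthonormal_on I (card B) v \<Longrightarrow>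
              weighted_kernel_sum I (card B) t v \<le> L"
  shows "rel_proj_const (span B) UNIV \<le> L"
proof -
  have approx: "rel_proj_const (span B) UNIV \<le> (L + d) / (1 - e)" if e: "0 < e" "e < 1" and d: "0 < d" for e d
  proof -
    obtain I where I: "finite I" "I \<noteq> {}"
        "\<And>k. \<exists>i\<in>I. \<forall>x\<in>span B. \<bar>apply_bcontfun x k - apply_bcontfun x i\<bar> \<le> e * norm x"
      using finite_norming_coordinates[OF B e(1)] by blast
    \<comment> \<open>The coordinates in \<open>I\<close> determine the norm up to the factor \<open>1 - e\<close>.\<close>
    have near: "(1 - e) * norm x \<le> C"
      if x: "x \<in> span B" and C: "\<And>i. i \<in> I \<Longrightarrow> \<bar>apply_bcontfun x i\<bar> \<le> C" for x C
    proof -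
      have "norm x \<le> C + e * norm x"
      proof (rule norm_bound)
        fix k
        obtain i where i: "i \<in> I" "\<bar>apply_bcontfun x k - apply_bcontfun x i\<bar> \<le> e * norm x"
          using I(3)[of k] x by blast
        then show "norm (apply_bcontfun x k) \<le> C + e * norm x" using C[OF i(1)] by simp
      qed
      then show ?thesis by (simp add: algebra_simps)
    qed
    define S where "S = {p :: nat \<Rightarrow> linfty. (\<forall>j. p j \<in> span B) \<and>
           (\<forall>x\<in>span B. (\<Sum>j\<in>I. apply_bcontfun x j *\<^sub>R p j) = x)}"
    define g where "g i p = (\<Sum>j\<in>I. \<bar>apply_bcontfun (p j) i\<bar>)" for i and p :: "nat \<Rightarrow> linfty"
    have "\<exists>p\<in>S. \<forall>i\<in>I. g i p < L + d"
    proof (rule finite_minimax[OF I(1,2)])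
      fix p q :: "nat \<Rightarrow> linfty" and u :: real
      assume pq: "p \<in> S" "q \<in> S" and u: "0 \<le> u" "u \<le> 1"
      show "\<exists>r\<in>S. \<forall>i\<in>I. g i r \<le> u * g i p + (1 - u) * g i q"
      proof (intro bexI ballI)
        let ?r = "\<lambda>j. u *\<^sub>R p j + (1 - u) *\<^sub>R q j"
        have "(\<Sum>j\<in>I. apply_bcontfun x j *\<^sub>R ?r j)
            = u *\<^sub>R (\<Sum>j\<in>I. apply_bcontfun x j *\<^sub>R p j) + (1 - u) *\<^sub>R (\<Sum>j\<in>I. apply_bcontfun x j *\<^sub>R q j)" for x
          by (simp add: scaleR_sum_right sum.distrib scaleR_add_right mult.commute)
        then have "(\<Sum>j\<in>I. apply_bcontfun x j *\<^sub>R ?r j) = x" if "x \<in> span B" for x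
          using pq that by (simp add: S_def scaleR_add_left[symmetric])
        then show "?r \<in> S"
          using pq by (auto simp: S_def intro!: span_add span_scale)
        fix i
        have "\<bar>apply_bcontfun (?r j) i\<bar> \<le> u * \<bar>apply_bcontfun (p j) i\<bar> + (1 - u) * \<bar>apply_bcontfun (q j) i\<bar>" for j
          using abs_triangle_ineq[of "u * apply_bcontfun (p j) i" "(1 - u) * apply_bcontfun (q j) i"] u
          by (simp add: abs_mult)
        then show "g i ?r \<le> u * g i p + (1 - u) * g i q"
          unfolding g_def sum_distrib_left sum.distrib[symmetric] by (rule sum_mono)
      qed
    next
      fix w :: "nat \<Rightarrow> real" assume w: "\<And>i. i \<in> I \<Longrightarrow> 0 < w i" "sum w I = 1"
      have inj: "x = 0" if x: "x \<in> span B" and z: "\<And>i. i \<in> I \<Longrightarrow> apply_bcontfun x i = 0" for x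
      proof -
        have "(1 - e) * norm x \<le> 0" using near[OF x, of 0] z by simp
        then show ?thesis using e by (simp add: mult_le_0_iff)
      qed
      show "\<exists>p\<in>S. (\<Sum>i\<in>I. w i * g i p) \<le> L"
        using weighted_orthogonal_projection[OF B I(1) inj w L[OF I(1)]]
        unfolding S_def g_def by blast
    qed (use d in \<open>auto simp: g_def sum_nonneg\<close>)
    then obtain p where p: "\<And>j. p j \<in> span B"
        "\<And>x. x \<in> span B \<Longrightarrow> (\<Sum>j\<in>I. apply_bcontfun x j *\<^sub>R p j) = x"
        "\<And>i. i \<in> I \<Longrightarrow> (\<Sum>j\<in>I. \<bar>apply_bcontfun (p j) i\<bar>) < L + d"
      unfolding S_def g_def by blast
    define P where "P x = (\<Sum>j\<in>I. apply_bcontfun x j *\<^sub>R p j)" for x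
    obtain i0 where i0: "i0 \<in> I" using I(2) by blast
    have "0 \<le> (\<Sum>j\<in>I. \<bar>apply_bcontfun (p j) i0\<bar>)" by (simp add: sum_nonneg)
    then have Ld: "0 \<le> L + d" using p(3)[OF i0] by linarith
    have PB: "P x \<in> span B" for x
      unfolding P_def by (intro span_sum span_scale p)
    have bnd: "norm (P x) \<le> (L + d) / (1 - e) * norm x" for x
    proof -
      have "\<bar>apply_bcontfun (P x) i\<bar> \<le> (L + d) * norm x" if i: "i \<in> I" for i
      proof -
        have "\<bar>apply_bcontfun (P x) i\<bar> \<le> (\<Sum>j\<in>I. \<bar>apply_bcontfun x j * apply_bcontfun (p j) i\<bar>)"
          unfolding P_def apply_bcontfun_sum by (simp add: sum_abs)
        also have "\<dots> \<le> (\<Sum>j\<in>I. norm x * \<bar>apply_bcontfun (p j) i\<bar>)"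
          unfolding abs_mult using norm_bounded[of x] by (intro sum_mono mult_right_mono) auto
        also have "\<dots> \<le> norm x * (L + d)"
          unfolding sum_distrib_left[symmetric] using p(3)[OF i] by (intro mult_left_mono) auto
        finally show ?thesis by (simp add: mult.commute)
      qed
      from near[OF PB this] show ?thesis using e by (simp add: field_simps)
    qed
    have lin: "linear_on UNIV P"
      unfolding linear_on_def P_def
      by (simp add: scaleR_add_left sum.distrib scaleR_sum_right)
    have "bounded_projection (span B) UNIV P"
      unfolding bounded_projection_def
    proof (intro conjI)
      show "\<exists>b. \<forall>x\<in>UNIV. norm (P x) \<le> b * norm x" using bnd by blast
    qed (use lin PB p(2) in \<open>auto simp: P_def\<close>)
    then show ?thesis using Ld e by (intro rel_proj_const_le(2)[OF _ _ _ bnd]) auto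
  qed
  have L0: "((\<lambda>d. (L + d) / (1 - d)) \<longlongrightarrow> (L + 0) / (1 - 0)) (at_right 0)"
    by (intro tendsto_intros) auto
  have "\<forall>\<^sub>F d in at_right 0. d \<in> {0<..<1::real}"
    by (rule eventually_at_right_real) simp
  then have "\<forall>\<^sub>F d in at_right (0::real). rel_proj_const (span B) UNIV \<le> (L + d) / (1 - d)"
    by (rule eventually_mono) (rule approx, simp_all)
  then have "rel_proj_const (span B) UNIV \<le> (L + 0) / (1 - 0)"
    by (intro tendsto_lowerbound[OF L0]) auto
  then show ?thesis by simp
qed

section \<open>Isometric embeddings of finite-dimensional spaces\<close>

lemma norm_on_sum_le:
  assumes "norm_on (span B) N" "finite A" "\<And>b. b \<in> A \<Longrightarrow> f b \<in> span B"
  shows "N (\<Sum>b\<in>A. f b) \<le> (\<Sum>b\<in>A. N (f b))"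
  using assms(2,3)
proof (induction A)
  case empty
  then show ?case using assms(1) span_zero[of B] by (auto simp: norm_on_def)
next
  case (insert b A)
  have "N (f b + (\<Sum>b\<in>A. f b)) \<le> N (f b) + N (\<Sum>b\<in>A. f b)"
    using assms(1) insert.prems span_sum[of A f B] by (auto simp: norm_on_def)
  then show ?case using insert by simp
qed

lemma norming_functional:
  assumes B: "finite B" and N: "norm_on (span B) N" and x: "x \<in> span B"
  shows "\<exists>g. linear g \<and> g x = N x \<and> (\<forall>u\<in>span B. \<bar>g u\<bar> \<le> N u)"
proof -
  have hom: "N (c *\<^sub>R u) = \<bar>c\<bar> * N u" if "u \<in> span B" for c u
    using N that by (simp add: norm_on_def)
  have N0: "N 0 = 0" "0 \<le> N x" using N span_zero[of B] x by (auto simp: norm_on_def)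
  have "\<exists>f. linear f \<and> f x = N x"
  proof (cases "x = 0")
    case True
    then show ?thesis using N0 by (intro exI[of _ "\<lambda>_. 0"]) (auto simp: linear_zero)
  next
    case False
    then have "independent {x}" by simp
    from linear_independent_extend[OF this, of "\<lambda>_. N x"] show ?thesis by auto
  qed
  then obtain f where f: "linear f" "f x = N x" by blast
  have fx: "f u \<le> N u" if u: "u \<in> span {x}" for u
  proof -
    obtain a where a: "u = a *\<^sub>R x" using u by (auto simp: span_singleton)
    have "a * N x \<le> \<bar>a\<bar> * N x" using N0(2) by (intro mult_right_mono) auto
    then show ?thesis using f hom[OF x] by (simp add: a linear_scale)
  qed
  have sp: "span ({x} \<union> B) = span B" using x by (simp add: span_redundant)
  have "sublinear_on (span ({x} \<union> B)) N"
    unfolding sp using N by (auto simp: sublinear_on_def norm_on_def)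
  from hahn_banach_finite[OF B this f(1) fx] obtain g where
    g: "linear g" "\<forall>u\<in>span {x}. g u = f u" "\<forall>u\<in>span B. g u \<le> N u" unfolding sp by blast
  have "\<bar>g u\<bar> \<le> N u" if u: "u \<in> span B" for u
  proof -
    have "g (- u) \<le> N (- u)" using g(3) span_neg[OF u] by blast
    moreover have "N (- u) = N u" using hom[OF u, of "-1"] by simp
    ultimately show ?thesis using g(3) u linear_neg[OF g(1), of u] by (auto simp: abs_le_iff)
  qed
  moreover have "g x = N x" using g(2) f(2) by (simp add: span_base)
  ultimately show ?thesis using g(1) by blast
qed

lemma countable_dense_span:
  assumes B: "finite B" and N: "norm_on (span B) N"
  shows "\<exists>D. countable D \<and> D \<noteq> {} \<and> D \<subseteq> span B \<and> (\<forall>y\<in>span B. \<forall>e>0. \<exists>x\<in>D. N (y - x) \<le> e)"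
proof -
  let ?f = "\<lambda>r. \<Sum>b\<in>B. real_of_rat (r b) *\<^sub>R b"
  let ?D = "?f ` (\<Pi>\<^sub>E b\<in>B. UNIV)"
  have "\<exists>x\<in>?D. N (y - x) \<le> e" if y: "y \<in> span B" and e: "e > 0" for y e
  proof -
    obtain a where a: "y = (\<Sum>b\<in>B. a b *\<^sub>R b)" using y span_finite[OF B] by auto
    have N0: "0 \<le> N b" if "b \<in> B" for b using N span_base[OF that] by (auto simp: norm_on_def)
    define M where "M = (\<Sum>b\<in>B. N b)"
    have M: "M \<ge> 0" unfolding M_def using N0 by (rule sum_nonneg)
    define d where "d = e / (M + 1)"
    have d: "d > 0" "d * M \<le> e" using e M by (auto simp: d_def field_simps)
    have "\<exists>q. \<bar>a b - real_of_rat q\<bar> \<le> d" for b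
    proof -
      obtain q where "a b < real_of_rat q" "real_of_rat q < a b + d"
        using of_rat_dense[of "a b" "a b + d"] d(1) by auto
      then show ?thesis by (intro exI[of _ q]) auto
    qed
    then obtain r where r: "\<And>b. \<bar>a b - real_of_rat (r b)\<bar> \<le> d" by metis
    have "N (y - ?f (restrict r B)) = N (\<Sum>b\<in>B. (a b - real_of_rat (r b)) *\<^sub>R b)"
      by (simp add: a sum_subtractf scaleR_diff_left)
    also have "\<dots> \<le> (\<Sum>b\<in>B. N ((a b - real_of_rat (r b)) *\<^sub>R b))"
      by (intro norm_on_sum_le[OF N B] span_scale span_base)
    also have "\<dots> = (\<Sum>b\<in>B. \<bar>a b - real_of_rat (r b)\<bar> * N b)"
      using N by (intro sum.cong refl) (simp add: norm_on_def span_base)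
    also have "\<dots> \<le> (\<Sum>b\<in>B. d * N b)" using r N0 by (intro sum_mono mult_right_mono)
    also have "\<dots> \<le> e" using d(2) by (simp add: M_def sum_distrib_left)
    finally have "N (y - ?f (restrict r B)) \<le> e" .
    moreover have "?f (restrict r B) \<in> ?D" by (rule imageI) auto
    ultimately show ?thesis by blast
  qed
  moreover have "countable ?D" using B by (intro countable_image countable_PiE) auto
  moreover have "?D \<noteq> {}" by (simp add: PiE_eq_empty_iff)
  moreover have "?D \<subseteq> span B" by (intro image_subsetI span_sum span_scale span_base)
  ultimately show ?thesis by (intro exI[of _ ?D]) blast
qed

text \<open>The coordinates of the embedding are norming functionals of a countable dense set. Existence
  matters because \<open>abs_proj_const\<close> chooses an arbitrary isometric embedding.\<close>

lemma isometric_embedding_exists: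
  assumes B: "finite B" and N: "norm_on (span B) N"
  shows "\<exists>j. isometric_embedding (span B) N j"
proof -
  obtain D where "countable D \<and> D \<noteq> {} \<and> D \<subseteq> span B \<and> (\<forall>y\<in>span B. \<forall>e>0. \<exists>x\<in>D. N (y - x) \<le> e)"
    using countable_dense_span[OF B N] by (elim exE)
  then have D: "countable D" "D \<noteq> {}" "D \<subseteq> span B"
      "\<And>y e. y \<in> span B \<Longrightarrow> e > 0 \<Longrightarrow> \<exists>x\<in>D. N (y - x) \<le> e" by simp_all
  have tri: "N (u + v) \<le> N u + N v" if "u \<in> span B" "v \<in> span B" for u v
    using N that by (auto simp: norm_on_def)
  have "\<exists>G. \<forall>x\<in>span B. linear (G x) \<and> G x x = N x \<and> (\<forall>u\<in>span B. \<bar>G x u\<bar> \<le> N u)"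
    using norming_functional[OF B N] by (intro bchoice) blast
  then obtain G where G: "\<And>x. x \<in> span B \<Longrightarrow> linear (G x)" "\<And>x. x \<in> span B \<Longrightarrow> G x x = N x"
      "\<And>x u. x \<in> span B \<Longrightarrow> u \<in> span B \<Longrightarrow> \<bar>G x u\<bar> \<le> N u" by blast
  define s where "s = from_nat_into D"
  have s: "s k \<in> span B" for k using from_nat_into[OF D(2)] D(3) by (auto simp: s_def)
  have sD: "\<exists>k. s k = x" if "x \<in> D" for x
    using from_nat_into_surj[OF D(1) that] by (simp add: s_def)
  define j where "j y = (Bcontfun (\<lambda>k. G (s k) y) :: linfty)" for y
  have ap: "apply_bcontfun (j y) k = G (s k) y" if y: "y \<in> span B" for y k
  proof -
    have "(\<lambda>k. G (s k) y) \<in> bcontfun"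
      using G(3)[OF s y] by (intro bcontfun_normI[of _ "N y"]) auto
    then show ?thesis by (simp add: j_def Bcontfun_inverse)
  qed
  have lin: "linear_on (span B) j"
    unfolding linear_on_def
  proof (intro conjI ballI allI)
    fix x y assume "x \<in> span B" "y \<in> span B"
    then show "j (x + y) = j x + j y"
      by (intro bcontfun_eqI) (simp add: ap span_add linear_add[OF G(1)[OF s]])
  next
    fix c x assume "x \<in> span B"
    then show "j (c *\<^sub>R x) = c *\<^sub>R j x"
      by (intro bcontfun_eqI) (simp add: ap span_scale linear_scale[OF G(1)[OF s]])
  qed
  have "norm (j y) = N y" if y: "y \<in> span B" for y
  proof (rule antisym)
    show "norm (j y) \<le> N y" by (rule norm_bound) (use y G(3)[OF s y] in \<open>simp add: ap\<close>)
    show "N y \<le> norm (j y)"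
    proof (rule field_le_epsilon)
      fix e :: real assume "e > 0"
      then obtain x where x: "x \<in> D" "N (y - x) \<le> e / 2" using D(4)[OF y, of "e / 2"] by auto
      obtain k where k: "s k = x" using sD[OF x(1)] by blast
      have xB: "x \<in> span B" and yx: "y - x \<in> span B"
        using x D(3) y by (auto intro: span_diff)
      have "N y \<le> N x + N (y - x)" using tri[OF xB yx] by simp
      also have "N x = G x y - G x (y - x)"
        using G(2)[OF xB] linear_diff[OF G(1)[OF xB]] by simp
      also have "G x y \<le> norm (j y)" using norm_bounded[of "j y" k] ap[OF y, of k] k by simp
      finally show "N y \<le> norm (j y) + e" using G(3)[OF xB yx] x(2) by linarith
    qed
  qed
  then show ?thesis using lin unfolding isometric_embedding_def by blast
qed

section \<open>Bounding the maximal projection constant by the extremal value\<close>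

text \<open>The image of an isometric embedding is the span of the linearly independent image of a basis,
  which is the form in which subspaces of \<open>\<ell>\<^sub>\<infinity>\<close> were treated above.\<close>

lemma abs_proj_const_le:
  fixes V :: "'a::real_vector set"
  assumes V: "subspace V" "dim V = n" "n \<ge> 1" and N: "norm_on V N"
    and L: "\<And>I t v. finite I \<Longrightarrow> unit_weight I t \<Longrightarrow> orthonormal_on I n v \<Longrightarrow> weighted_kernel_sum I n t v \<le> L"
  shows "abs_proj_const V N \<le> L"
proof -
  obtain B where B0: "B \<subseteq> V" "independent B" "V \<subseteq> span B" "card B = dim V"
    using basis_exists[of V] by blast
  have "span B = V" using span_minimal[OF B0(1) V(1)] B0(3) by (rule subset_antisym)
  moreover have "card B = n" using B0(4) V(2) by simp
  ultimately have B: "span B = V" "independent B" "card B = n" using B0(2) by blast+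
  have "finite B" using B(3) V(3) by (intro card_ge_0_finite) simp
  note B = B this
  define j where "j = (SOME j. isometric_embedding V N j)"
  have "\<exists>j. isometric_embedding V N j"
    using isometric_embedding_exists[OF B(4), of N] N unfolding B(1) by blast
  then have "isometric_embedding V N j"
    unfolding j_def by (rule someI_ex)
  then have j: "linear_on V j" "\<And>x. x \<in> V \<Longrightarrow> norm (j x) = N x"
    by (auto simp: isometric_embedding_def)
  obtain J where J: "linear J" "\<And>b. b \<in> B \<Longrightarrow> J b = j b"
    using linear_independent_extend[OF B(2), of j] by blast
  have zero: "0 \<in> V" using subspace_0[OF V(1)] .
  have Jj: "J x = j x" if "x \<in> V" for x
  proof -
    have "x \<in> span B" using that B by simp
    then have "x \<in> V \<and> J x = j x"
    proof (induction rule: span_induct_alt)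
      case base
      have "j (0 *\<^sub>R 0) = 0 *\<^sub>R j 0" using j(1) zero unfolding linear_on_def by blast
      then show ?case using zero linear_0[OF J(1)] by simp
    next
      case (step c x y)
      then have "x \<in> V" "y \<in> V" using B0 by auto
      then have "j (c *\<^sub>R x + y) = c *\<^sub>R j x + j y"
        using j(1) subspace_scale[OF V(1)] unfolding linear_on_def by metis
      then show ?case
        using step J(2) \<open>x \<in> V\<close> \<open>y \<in> V\<close> V(1)
        by (simp add: linear_add[OF J(1)] linear_scale[OF J(1)] subspace_add subspace_scale)
    qed
    then show ?thesis by simp
  qed
  have inj: "inj_on J (span B)"
  proof (rule inj_onI)
    fix x y assume xy: "x \<in> span B" "y \<in> span B" "J x = J y"
    then have d: "x - y \<in> V" using B(1) V(1) by (simp add: subspace_diff)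
    have "N (x - y) = norm (J (x - y))" using j(2)[OF d] Jj[OF d] by simp
    also have "\<dots> = 0" using xy(3) by (simp add: linear_diff[OF J(1)])
    finally show "x = y" using N d unfolding norm_on_def by auto
  qed
  have "j ` V = span (J ` B)"
    using linear_span_image[OF J(1), of B] B(1) Jj by auto
  moreover have "independent (J ` B)"
    using linear_independent_injective_image[OF J(1) B(2) inj] .
  moreover have "card (J ` B) = n"
    using card_image[OF inj_on_subset[OF inj]] span_superset B(3) by metis
  ultimately show ?thesis
    using rel_proj_const_in_linfty_le[of "J ` B" L] L B(4) by (simp add: abs_proj_const_def j_def)
qed

definition vec_on :: "nat set \<Rightarrow> (nat \<Rightarrow> real) \<Rightarrow> nat \<Rightarrow>\<^sub>0 real" where
  "vec_on I y = (\<Sum>i\<in>I. y i *\<^sub>R Poly_Mapping.single i 1)"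

lemma lookup_vec_on:
  "finite I \<Longrightarrow> Poly_Mapping.lookup (vec_on I y) i = (if i \<in> I then y i else 0)"
  unfolding vec_on_def
  by (auto simp: lookup_sum lookup_scaleR lookup_single when_def if_distrib cong: if_cong)

lemma dim_span_orthonormal:
  assumes I: "finite I" and v: "orthonormal_on I n v"
  shows "dim (span ((\<lambda>k. vec_on I (v k)) ` {..<n})) = n"
proof -
  let ?u = "\<lambda>k. vec_on I (v k)"
  have inner: "(\<Sum>i\<in>I. Poly_Mapping.lookup (\<Sum>k<n. a k *\<^sub>R ?u k) i * v l i) = a l" if l: "l < n" for a l
  proof -
    have "(\<Sum>i\<in>I. Poly_Mapping.lookup (\<Sum>k<n. a k *\<^sub>R ?u k) i * v l i)
        = (\<Sum>i\<in>I. \<Sum>k<n. a k * (v k i * v l i))"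
      using I by (intro sum.cong refl) (simp add: lookup_sum lookup_scaleR lookup_vec_on sum_distrib_right mult.assoc)
    also have "\<dots> = (\<Sum>k<n. a k * (\<Sum>i\<in>I. v k i * v l i))"
      unfolding sum_distrib_left by (rule sum.swap)
    also have "\<dots> = (\<Sum>k<n. if k = l then a k else 0)"
      using v l by (intro sum.cong refl) (auto simp: orthonormal_on_def)
    finally show ?thesis using l by simp
  qed
  have inj: "inj_on ?u {..<n}"
  proof (rule inj_onI)
    fix k l assume kl: "k \<in> {..<n}" "l \<in> {..<n}" "?u k = ?u l"
    have delta: "(\<Sum>i<n. (if i = m then 1 else 0) *\<^sub>R ?u i) = ?u m" if "m < n" for m
    proof -
      have "(\<Sum>i<n. (if i = m then 1 else 0) *\<^sub>R ?u i) = (\<Sum>i<n. if i = m then ?u i else 0)"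
        by (rule sum.cong) auto
      then show ?thesis using that by simp
    qed
    have k: "k < n" and l: "l < n" using kl by auto
    show "k = l"
      using inner[OF l, of "\<lambda>i. if i = k then 1 else 0"] inner[OF l, of "\<lambda>i. if i = l then 1 else 0"]
      unfolding delta[OF k] delta[OF l] kl(3) by (simp split: if_splits)
  qed
  have "independent (?u ` {..<n})"
  proof (rule independent_if_scalars_zero)
    fix f x assume 0: "(\<Sum>y\<in>?u ` {..<n}. f y *\<^sub>R y) = 0" and x: "x \<in> ?u ` {..<n}"
    obtain l where l: "l < n" "x = ?u l" using x by blast
    have "(\<Sum>k<n. f (?u k) *\<^sub>R ?u k) = 0" using 0 by (simp add: sum.reindex[OF inj])
    then show "f x = 0" using inner[OF l(1), of "\<lambda>k. f (?u k)"] l(2) by simp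
  qed auto
  then show ?thesis using card_image[OF inj] by (simp add: dim_eq_card_independent)
qed

lemma orthonormal_on_standard: "orthonormal_on {..<n} n (\<lambda>k i. if k = i then 1 else 0)"
proof -
  let ?e = "\<lambda>k i :: nat. if k = i then 1 else (0::real)"
  have "(\<Sum>i<n. ?e k i * ?e l i) = (if k = l then 1 else 0)" if k: "k < n" for k l
  proof -
    have "(\<Sum>i<n. ?e k i * ?e l i) = (\<Sum>i<n. if i = k then ?e l k else 0)"
      by (rule sum.cong) auto
    also have "\<dots> = ?e l k" using k by simp
    finally show ?thesis by auto
  qed
  then show ?thesis unfolding orthonormal_on_def by blast
qed

lemma max_proj_const_le:
  assumes n: "n \<ge> 1"
  shows "max_proj_const n \<le> extremal_value n"
  unfolding max_proj_const_def
proof (rule cSup_least)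
  let ?e = "\<lambda>k i :: nat. if k = i then 1 else (0::real)"
  have d: "dim (span ((\<lambda>k. vec_on {..<n} (?e k)) ` {..<n})) = n" (is "dim ?V = n")
    by (intro dim_span_orthonormal orthonormal_on_standard) auto
  have "norm_on ?V norm" by (simp add: norm_on_def norm_triangle_ineq)
  with d have "abs_proj_const ?V norm \<in>
      {abs_proj_const V N |(V :: (nat \<Rightarrow>\<^sub>0 real) set) N. subspace V \<and> dim V = n \<and> norm_on V N}"
    by (intro CollectI exI[of _ ?V] exI[of _ norm] conjI refl subspace_span)
  then show "{abs_proj_const V N |(V :: (nat \<Rightarrow>\<^sub>0 real) set) N. subspace V \<and> dim V = n \<and> norm_on V N} \<noteq> {}"
    by (rule ex_in_conv[THEN iffD1, OF exI])
next
  fix x assume "x \<in> {abs_proj_const V N |(V :: (nat \<Rightarrow>\<^sub>0 real) set) N. subspace V \<and> dim V = n \<and> norm_on V N}"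
  then obtain V :: "(nat \<Rightarrow>\<^sub>0 real) set" and N
    where "x = abs_proj_const V N" "subspace V" "dim V = n" "norm_on V N" by (elim CollectE exE conjE)
  moreover have "weighted_kernel_sum I n t v \<le> extremal_value n"
    if "finite I" "unit_weight I t" "orthonormal_on I n v" for I t v
    unfolding extremal_value_def using that by (intro cSup_upper bdd_above_weighted_kernel_sum) blast
  ultimately show "x \<le> extremal_value n" using abs_proj_const_le n by blast
qed

section \<open>Extremal pairs and their first-order conditions\<close>

lemma compact_function_box:
  fixes S :: "'i \<Rightarrow> 'b::topological_space set"
  assumes "\<And>i. compact (S i)"
  shows "compact {f. \<forall>i. f i \<in> S i}"
proof -
  have "compactin (product_topology (\<lambda>_. euclidean) UNIV) (PiE UNIV S)"
    using assms by (simp add: compactin_PiE)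
  moreover have "PiE UNIV S = {f. \<forall>i. f i \<in> S i}" by (auto simp: PiE_iff)
  ultimately show ?thesis by (simp add: euclidean_product_topology)
qed

definition bil_form :: "nat set \<Rightarrow> (nat \<Rightarrow> nat \<Rightarrow> real) \<Rightarrow> (nat \<Rightarrow> real) \<Rightarrow> (nat \<Rightarrow> real) \<Rightarrow> real" where
  "bil_form I A x y = (\<Sum>i\<in>I. \<Sum>j\<in>I. x i * y j * A i j)"

lemma bil_form_sym:
  assumes "\<And>i j. A i j = A j i"
  shows "bil_form I A x y = bil_form I A y x"
  unfolding bil_form_def by (subst sum.swap) (simp add: assms mult.commute)

lemma bil_form_line:
  assumes "\<And>i j. A i j = A j i"
  shows "bil_form I A (\<lambda>i. x i + a * h i) (\<lambda>i. x i + a * h i)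
       = bil_form I A x x + 2 * a * bil_form I A h x + a\<^sup>2 * bil_form I A h h"
proof -
  have "bil_form I A (\<lambda>i. x i + a * h i) (\<lambda>i. x i + a * h i)
      = bil_form I A x x + a * bil_form I A h x + a * bil_form I A x h + a\<^sup>2 * bil_form I A h h"
    unfolding bil_form_def
    by (simp add: algebra_simps sum.distrib sum_distrib_left power2_eq_square)
  then show ?thesis using bil_form_sym[OF assms, where I = I and x = x and y = h] by simp
qed

lemma bil_form_scale: "bil_form I A (\<lambda>i. c * x i) (\<lambda>i. c * x i) = c\<^sup>2 * bil_form I A x x"
  unfolding bil_form_def by (simp add: sum_distrib_left power2_eq_square mult_ac)

lemma linear_term_zero:
  fixes a b :: real
  assumes "\<And>x. a * x + b * x\<^sup>2 \<le> 0"
  shows "a = 0"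
proof (rule ccontr)
  assume a: "a \<noteq> 0"
  \<comment> \<open>Small enough that the linear term dominates the quadratic one.\<close>
  define x where "x = a / (\<bar>b\<bar> + 1)"
  have "a * x + b * x\<^sup>2 \<ge> x\<^sup>2 * (\<bar>b\<bar> + 1) - \<bar>b\<bar> * x\<^sup>2"
  proof -
    have "a * x = x\<^sup>2 * (\<bar>b\<bar> + 1)"
      by (simp add: x_def power2_eq_square)
    moreover have "b * x\<^sup>2 \<ge> - (\<bar>b\<bar> * x\<^sup>2)"
      by (metis abs_ge_minus_self abs_minus_cancel minus_mult_left mult_right_mono zero_le_power2 minus_le_iff)
    ultimately show ?thesis by linarith
  qed
  moreover have "x\<^sup>2 * (\<bar>b\<bar> + 1) - \<bar>b\<bar> * x\<^sup>2 = x\<^sup>2" by (simp add: algebra_simps)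
  moreover have "x\<^sup>2 > 0" using a by (auto simp: x_def)
  ultimately show False using assms[of x] by linarith
qed

text \<open>A vector at which the quotient of a quadratic form by the squared norm is maximal is a critical
  point. Maximality is assumed along the line through \<open>x\<close> with direction \<open>h\<close>, so that the
  same statement serves for a maximum over the sphere and for a maximum over one vector of an
  orthonormal family.\<close>

lemma rayleigh_first_order:
  assumes A: "\<And>i j. A i j = A j i"
    and max: "\<And>a. bil_form I A (\<lambda>i. x i + a * h i) (\<lambda>i. x i + a * h i) \<le> \<mu> * (\<Sum>i\<in>I. (x i + a * h i)\<^sup>2)"
    and eq: "bil_form I A x x = \<mu> * (\<Sum>i\<in>I. (x i)\<^sup>2)"
  shows "bil_form I A h x = \<mu> * (\<Sum>i\<in>I. h i * x i)"
proof -
  have sq: "(\<Sum>i\<in>I. (x i + a * h i)\<^sup>2) = (\<Sum>i\<in>I. (x i)\<^sup>2) + 2 * a * (\<Sum>i\<in>I. h i * x i) + a\<^sup>2 * (\<Sum>i\<in>I. (h i)\<^sup>2)" for a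
    by (simp add: power2_eq_square algebra_simps sum.distrib sum_distrib_left)
  have "2 * (bil_form I A h x - \<mu> * (\<Sum>i\<in>I. h i * x i)) = 0"
  proof (rule linear_term_zero[where b = "bil_form I A h h - \<mu> * (\<Sum>i\<in>I. (h i)\<^sup>2)"])
    fix a
    show "2 * (bil_form I A h x - \<mu> * (\<Sum>i\<in>I. h i * x i)) * a
        + (bil_form I A h h - \<mu> * (\<Sum>i\<in>I. (h i)\<^sup>2)) * a\<^sup>2 \<le> 0"
      using max[of a] unfolding bil_form_line[OF A] sq eq by (simp add: algebra_simps)
  qed
  then show ?thesis by simp
qed

lemma gram_kernel_sym: "gram_kernel n v i j = gram_kernel n v j i"
  by (simp add: gram_kernel_def mult.commute)

lemma sum_bil_form_eq:
  "(\<Sum>k<n. bil_form I A (v k) (v k)) = (\<Sum>i\<in>I. \<Sum>j\<in>I. A i j * gram_kernel n v i j)"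
proof -
  have "(\<Sum>k<n. bil_form I A (v k) (v k)) = (\<Sum>i\<in>I. \<Sum>k<n. \<Sum>j\<in>I. v k i * v k j * A i j)"
    unfolding bil_form_def by (rule sum.swap)
  also have "\<dots> = (\<Sum>i\<in>I. \<Sum>j\<in>I. \<Sum>k<n. v k i * v k j * A i j)"
    by (intro sum.cong refl sum.swap)
  also have "\<dots> = (\<Sum>i\<in>I. \<Sum>j\<in>I. A i j * gram_kernel n v i j)"
    by (simp add: gram_kernel_def sum_distrib_left mult_ac)
  finally show ?thesis .
qed

text \<open>The constraints and the function depend only on the entries with index in \<open>I\<close> and \<open>k < n\<close>; the
  other entries can be set to zero. All entries then lie in \<open>[-1, 1]\<close>, and the product of these
  intervals is compact.\<close>

lemma perturbed_kernel_sum_attains_max: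
  fixes F :: "(nat \<Rightarrow> real) \<Rightarrow> (nat \<Rightarrow> nat \<Rightarrow> real) \<Rightarrow> real"
  assumes I: "finite I" and 0: "unit_weight I t0" "orthonormal_on I n v0"
    and F: "\<And>t v. F t v = (\<Sum>i\<in>I. \<Sum>j\<in>I. t i * t j * (\<bar>gram_kernel n v i j\<bar> + \<eta>))"
  shows "\<exists>t v. unit_weight I t \<and> orthonormal_on I n v \<and>
           (\<forall>t' v'. unit_weight I t' \<longrightarrow> orthonormal_on I n v' \<longrightarrow> F t' v' \<le> F t v)"
proof -
  define C where "C = {p. unit_weight I (fst p) \<and> orthonormal_on I n (snd p)}"
  define K where "K = {t :: nat \<Rightarrow> real. \<forall>i. t i \<in> {-1..1}} \<times> {v :: nat \<Rightarrow> nat \<Rightarrow> real. \<forall>k. v k \<in> {f. \<forall>i. f i \<in> {-1..1}}}"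
  have cfst: "continuous_on UNIV (\<lambda>p :: (nat \<Rightarrow> real) \<times> (nat \<Rightarrow> nat \<Rightarrow> real). fst p i)" for i
    by (rule continuous_on_product_then_coordinatewise) (intro continuous_intros)
  have csnd: "continuous_on UNIV (\<lambda>p :: (nat \<Rightarrow> real) \<times> (nat \<Rightarrow> nat \<Rightarrow> real). snd p k i)" for k i
    by (rule continuous_on_product_then_coordinatewise, rule continuous_on_product_then_coordinatewise)
       (intro continuous_intros)
  note cont = cfst csnd
  have "compact K"
    unfolding K_def by (intro compact_Times compact_function_box) auto
  moreover have "closed C"
    unfolding C_def unit_weight_def orthonormal_on_def Ball_def
    by (intro closed_Collect_conj closed_Collect_all closed_Collect_imp closed_Collect_eq closed_Collect_le
        open_Collect_const continuous_intros cont)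
  ultimately have comp: "compact (K \<inter> C)" by (rule compact_Int_closed)
  define cut where "cut p = ((\<lambda>i. if i \<in> I then fst p i else 0), (\<lambda>k i. if k < n \<and> i \<in> I then snd p k i else 0))"
    for p :: "(nat \<Rightarrow> real) \<times> (nat \<Rightarrow> nat \<Rightarrow> real)"
  have cutC: "cut p \<in> K \<inter> C" if p: "p \<in> C" for p
  proof
    have u: "unit_weight I (fst p)" and o: "orthonormal_on I n (snd p)" using p by (auto simp: C_def)
    show "cut p \<in> C" using u o by (simp add: C_def cut_def unit_weight_def orthonormal_on_def)
    have le1: "\<bar>f i\<bar> \<le> 1" if "(\<Sum>i\<in>I. (f i)\<^sup>2) = 1" "i \<in> I" for f :: "nat \<Rightarrow> real" and i
    proof -
      have "(f i)\<^sup>2 \<le> (\<Sum>i\<in>I. (f i)\<^sup>2)" using I that(2) by (intro member_le_sum) auto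
      then show ?thesis using that(1) abs_square_le_1[of "f i"] by simp
    qed
    have "\<bar>fst p i\<bar> \<le> 1" if "i \<in> I" for i using le1[of "fst p"] that u by (simp add: unit_weight_def)
    moreover have "\<bar>snd p k i\<bar> \<le> 1" if "i \<in> I" "k < n" for k i
      using le1[of "snd p k"] that o by (simp add: orthonormal_on_def power2_eq_square)
    ultimately show "cut p \<in> K" by (auto simp: K_def cut_def abs_le_iff minus_le_iff)
  qed
  have cutF: "F (fst (cut p)) (snd (cut p)) = F (fst p) (snd p)" for p
    unfolding F by (intro sum.cong refl) (simp add: cut_def gram_kernel_def)
  have "continuous_on (K \<inter> C) (\<lambda>p. F (fst p) (snd p))"
    unfolding F gram_kernel_def
    by (intro continuous_intros continuous_on_subset[OF cfst] continuous_on_subset[OF csnd]) auto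
  moreover have "K \<inter> C \<noteq> {}" using cutC[of "(t0, v0)"] 0 by (auto simp: C_def)
  ultimately obtain p where p: "p \<in> K \<inter> C" "\<forall>q\<in>K \<inter> C. F (fst q) (snd q) \<le> F (fst p) (snd p)"
    using continuous_attains_sup[OF comp] by blast
  have "F t' v' \<le> F (fst p) (snd p)" if "unit_weight I t'" "orthonormal_on I n v'" for t' v'
    using p(2) cutC[of "(t', v')"] cutF[of "(t', v')"] that by (force simp: C_def)
  then show ?thesis using p(1) unfolding C_def by blast
qed

text \<open>A vector of an orthonormal family may be tilted towards a vector \<open>h\<close> that is orthogonal to the whole
  family, and then normalised.\<close>

lemma orthonormal_on_replace:
  assumes v: "orthonormal_on I n v" and k: "k < n" and h: "\<And>l. l < n \<Longrightarrow> (\<Sum>i\<in>I. h i * v l i) = 0"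
    and r: "r\<^sup>2 = (\<Sum>i\<in>I. (v k i + a * h i)\<^sup>2)" "r \<noteq> 0"
  shows "orthonormal_on I n (v(k := \<lambda>i. (1 / r) * (v k i + a * h i)))"
    (is "orthonormal_on I n ?v")
proof -
  have vv: "(\<Sum>i\<in>I. v l i * v m i) = (if l = m then 1 else 0)" if "l < n" "m < n" for l m
    using v that by (simp add: orthonormal_on_def)
  have kk: "(\<Sum>i\<in>I. ?v k i * ?v k i) = 1"
  proof -
    have "(\<Sum>i\<in>I. ?v k i * ?v k i) = (1 / r\<^sup>2) * (\<Sum>i\<in>I. (v k i + a * h i)\<^sup>2)"
      by (simp add: sum_distrib_left power2_eq_square)
    then show ?thesis using r(2) by (simp flip: r(1))
  qed
  have kl: "(\<Sum>i\<in>I. ?v k i * ?v l i) = 0" if l: "l < n" "l \<noteq> k" for l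
  proof -
    have "(\<Sum>i\<in>I. ?v k i * ?v l i) = (1 / r) * ((\<Sum>i\<in>I. v k i * v l i) + a * (\<Sum>i\<in>I. h i * v l i))"
      using l by (simp add: sum_distrib_left sum.distrib[symmetric] algebra_simps)
    then show ?thesis using vv[OF k l(1)] h[OF l(1)] l(2) by simp
  qed
  show ?thesis
    unfolding orthonormal_on_def
  proof (intro allI impI)
    fix l m assume lm: "l < n" "m < n"
    have "(\<Sum>i\<in>I. ?v l i * ?v m i) = (\<Sum>i\<in>I. ?v m i * ?v l i)" by (simp add: mult.commute)
    then show "(\<Sum>i\<in>I. ?v l i * ?v m i) = (if l = m then 1 else 0)"
      using kk kl[OF lm(1)] kl[OF lm(2)] vv[OF lm] by (cases "l = k"; cases "m = k") auto
  qed
qed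

text \<open>The pair maximises \<open>\<Sum>\<^sub>i\<^sub>j t\<^sub>i t\<^sub>j (\<bar>K\<^sub>i\<^sub>j\<bar> + \<eta>)\<close>, and \<open>\<mu>\<close> is the maximum. As \<open>t\<close> maximises a
  quadratic form on the unit sphere, it is an eigenvector of the matrix \<open>\<bar>K\<bar> + \<eta>\<close> with
  eigenvalue \<open>\<mu>\<close>; this matrix has positive entries, so \<open>t\<close> is strictly positive. For the kernel
  \<open>K'\<close> of a competing family, \<open>\<Sum>\<^sub>i\<^sub>j t\<^sub>i t\<^sub>j sgn K\<^sub>i\<^sub>j K'\<^sub>i\<^sub>j \<le> \<Sum>\<^sub>i\<^sub>j t\<^sub>i t\<^sub>j \<bar>K'\<^sub>i\<^sub>j\<bar>\<close>, with
  equality for \<open>K' = K\<close>. So \<open>v\<close> also maximises the sum of the values of the quadratic form with matrix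
  \<open>t\<^sub>i t\<^sub>j sgn K\<^sub>i\<^sub>j\<close>. The last conclusion says that the span of \<open>v\<close> is invariant under this
  matrix.\<close>

lemma extremal_pair:
  assumes I: "finite I" and 0: "unit_weight I t0" "orthonormal_on I n v0" and \<gamma>: "\<gamma> > 0"
  shows "\<exists>t v \<mu>. unit_weight I t \<and> orthonormal_on I n v \<and> (\<forall>i\<in>I. 0 < t i) \<and>
           (\<forall>i\<in>I. (\<Sum>j\<in>I. t j * \<bar>gram_kernel n v i j\<bar>) \<le> \<mu> * t i) \<and>
           weighted_kernel_sum I n t0 v0 \<le> \<mu> \<and> \<mu> - \<gamma> \<le> weighted_kernel_sum I n t v \<and>
           (\<forall>k<n. \<forall>h. (\<forall>l<n. (\<Sum>i\<in>I. h i * v l i) = 0) \<longrightarrow>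
              bil_form I (\<lambda>i j. t i * t j * sgn (gram_kernel n v i j)) h (v k) = 0)"
proof -
  have "I \<noteq> {}" using 0(1) by (auto simp: unit_weight_def)
  then have cI: "real (card I) > 0" using I by (simp add: card_gt_0_iff)
  \<comment> \<open>As \<open>(\<Sum>\<^sub>i t\<^sub>i)\<^sup>2 \<le> card I\<close>, the perturbation changes the value by at most \<open>\<gamma>\<close>.\<close>
  define \<eta> where "\<eta> = \<gamma> / card I"
  have \<eta>: "\<eta> > 0" "\<eta> * card I = \<gamma>" using cI \<gamma> by (auto simp: \<eta>_def)
  define F where "F t v = (\<Sum>i\<in>I. \<Sum>j\<in>I. t i * t j * (\<bar>gram_kernel n v i j\<bar> + \<eta>))" for t v
  have Fw: "F t v = weighted_kernel_sum I n t v + \<eta> * (\<Sum>i\<in>I. t i)\<^sup>2" for t v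
  proof -
    have "(\<Sum>i\<in>I. t i)\<^sup>2 = (\<Sum>i\<in>I. \<Sum>j\<in>I. t i * t j)" by (simp add: power2_eq_square sum_product)
    then show ?thesis
      by (simp add: F_def weighted_kernel_sum_def distrib_left sum.distrib sum_distrib_left mult_ac)
  qed
  obtain t v where t: "unit_weight I t" and v: "orthonormal_on I n v"
    and max: "\<And>t' v'. unit_weight I t' \<Longrightarrow> orthonormal_on I n v' \<Longrightarrow> F t' v' \<le> F t v"
    using perturbed_kernel_sum_attains_max[OF I 0 F_def] by blast
  define \<mu> where "\<mu> = F t v"
  have t0: "0 \<le> t i" if "i \<in> I" for i using t that by (simp add: unit_weight_def)
  have t1: "(\<Sum>i\<in>I. (t i)\<^sup>2) = 1" using t by (simp add: unit_weight_def)
  define A where "A i j = \<bar>gram_kernel n v i j\<bar> + \<eta>" for i j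
  have A: "A i j = A j i" for i j by (simp add: A_def gram_kernel_sym[of n v i])
  have FA: "F s v = bil_form I A s s" for s by (simp add: F_def bil_form_def A_def)
  \<comment> \<open>By homogeneity and passage to \<open>\<bar>s\<bar>\<close>, the maximality over nonnegative unit vectors extends to all vectors.\<close>
  have ray: "bil_form I A s s \<le> \<mu> * (\<Sum>i\<in>I. (s i)\<^sup>2)" for s
  proof -
    define r where "r = sqrt (\<Sum>i\<in>I. (s i)\<^sup>2)"
    have r2: "r\<^sup>2 = (\<Sum>i\<in>I. (s i)\<^sup>2)" by (simp add: r_def sum_nonneg)
    show ?thesis
    proof (cases "r = 0")
      case True
      then have "\<forall>i\<in>I. s i = 0" using r2 I by (simp add: sum_nonneg_eq_0_iff)
      then show ?thesis by (simp add: bil_form_def)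
    next
      case False
      define s' where "s' i = (1 / r) * \<bar>s i\<bar>" for i
      have "r > 0" using False by (simp add: r_def sum_nonneg order_less_le)
      then have "unit_weight I s'"
        using False by (simp add: unit_weight_def s'_def power_divide sum_divide_distrib[symmetric] flip: r2)
      then have "F s' v \<le> \<mu>" unfolding \<mu>_def by (rule max[OF _ v])
      then have "bil_form I A s' s' \<le> \<mu>" unfolding FA .
      then have "(1 / r)\<^sup>2 * bil_form I A (\<lambda>i. \<bar>s i\<bar>) (\<lambda>i. \<bar>s i\<bar>) \<le> \<mu>"
        unfolding s'_def bil_form_scale .
      then have "bil_form I A (\<lambda>i. \<bar>s i\<bar>) (\<lambda>i. \<bar>s i\<bar>) \<le> \<mu> * r\<^sup>2"
        using False by (simp add: power_divide divide_le_eq)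
      moreover have "bil_form I A s s \<le> bil_form I A (\<lambda>i. \<bar>s i\<bar>) (\<lambda>i. \<bar>s i\<bar>)"
        unfolding bil_form_def using \<eta>(1)
        by (intro sum_mono mult_right_mono) (simp_all add: abs_mult[symmetric] A_def)
      ultimately show ?thesis using r2 by simp
    qed
  qed
  have eig: "(\<Sum>j\<in>I. A i j * t j) = \<mu> * t i" if i: "i \<in> I" for i
  proof -
    let ?e = "\<lambda>j. if j = i then 1 else (0::real)"
    have "bil_form I A ?e t = \<mu> * (\<Sum>j\<in>I. ?e j * t j)"
      by (rule rayleigh_first_order[OF A ray]) (simp add: t1 \<mu>_def FA)
    moreover have "(\<Sum>j\<in>I. ?e j * t j) = (\<Sum>j\<in>I. if j = i then t j else 0)"
      by (rule sum.cong) auto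
    moreover have "bil_form I A ?e t = (\<Sum>k\<in>I. if k = i then (\<Sum>j\<in>I. t j * A k j) else 0)"
      unfolding bil_form_def by (rule sum.cong) auto
    ultimately show ?thesis using i I by (simp add: mult.commute)
  qed
  have "sum t I > 0"
  proof (rule ccontr)
    assume "\<not> sum t I > 0"
    then have "sum t I = 0" using sum_nonneg[of I t] t0 by fastforce
    then have "\<forall>i\<in>I. t i = 0" using t0 I by (simp add: sum_nonneg_eq_0_iff)
    then show False using t1 by simp
  qed
  then have tpos: "0 < t i" if i: "i \<in> I" for i
  proof -
    have "0 < \<eta> * sum t I" using \<open>sum t I > 0\<close> \<eta> by simp
    also have "\<dots> \<le> (\<Sum>j\<in>I. A i j * t j)"
      unfolding sum_distrib_left using t0 by (intro sum_mono mult_right_mono) (auto simp: A_def)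
    finally have "0 < \<mu> * t i" unfolding eig[OF i] .
    then have "t i \<noteq> 0" by auto
    then show ?thesis using t0[OF i] by (simp add: order_less_le)
  qed
  have col: "(\<Sum>j\<in>I. t j * \<bar>gram_kernel n v i j\<bar>) \<le> \<mu> * t i" if i: "i \<in> I" for i
    unfolding eig[OF i, symmetric] mult.commute[of "t _"] using t0 \<eta>(1)
    by (intro sum_mono mult_right_mono) (auto simp: A_def)
  have "weighted_kernel_sum I n t0 v0 \<le> \<mu>"
  proof -
    have "0 \<le> \<eta> * (\<Sum>i\<in>I. t0 i)\<^sup>2" using \<eta>(1) by simp
    then have "weighted_kernel_sum I n t0 v0 \<le> F t0 v0" unfolding Fw by simp
    also have "\<dots> \<le> \<mu>" unfolding \<mu>_def by (rule max[OF 0])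
    finally show ?thesis .
  qed
  moreover have "\<mu> - \<gamma> \<le> weighted_kernel_sum I n t v"
  proof -
    have "(\<Sum>i\<in>I. t i)\<^sup>2 \<le> card I"
      using Cauchy_Schwarz_ineq_sum[of t "\<lambda>_. 1" I] t1 by simp
    then have "\<eta> * (\<Sum>i\<in>I. t i)\<^sup>2 \<le> \<gamma>" using \<eta> by (metis less_imp_le mult_left_mono)
    then show ?thesis unfolding \<mu>_def Fw by simp
  qed
  moreover have "bil_form I S h (v k) = 0"
    if S: "S = (\<lambda>i j. t i * t j * sgn (gram_kernel n v i j))"
      and k: "k < n" and h: "\<And>l. l < n \<Longrightarrow> (\<Sum>i\<in>I. h i * v l i) = 0" for S h k
  proof -
    have Ssym: "S i j = S j i" for i j by (simp add: S gram_kernel_sym[of n v i])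
    have SF: "(\<Sum>k<n. bil_form I S (w k) (w k)) \<le> weighted_kernel_sum I n t w" for w
      unfolding sum_bil_form_eq weighted_kernel_sum_def
    proof (intro sum_mono)
      fix i j assume ij: "i \<in> I" "j \<in> I"
      have "sgn (gram_kernel n v i j) * gram_kernel n w i j \<le> \<bar>gram_kernel n w i j\<bar>"
        by (auto simp: sgn_if abs_ge_minus_self)
      then have "t i * t j * (sgn (gram_kernel n v i j) * gram_kernel n w i j) \<le> t i * t j * \<bar>gram_kernel n w i j\<bar>"
        using t0 ij by (intro mult_left_mono) auto
      then show "S i j * gram_kernel n w i j \<le> t i * t j * \<bar>gram_kernel n w i j\<bar>"
        by (simp add: S mult.assoc)
    qed
    have Sv: "(\<Sum>k<n. bil_form I S (v k) (v k)) = weighted_kernel_sum I n t v"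
      unfolding sum_bil_form_eq weighted_kernel_sum_def S
      by (intro sum.cong refl) (simp add: mult.assoc abs_sgn mult.commute)
    have Smax: "(\<Sum>k<n. bil_form I S (w k) (w k)) \<le> (\<Sum>k<n. bil_form I S (v k) (v k))"
      if "orthonormal_on I n w" for w
      using SF[of w] max[OF t that] unfolding Sv Fw by simp
    have vk: "(\<Sum>i\<in>I. (v k i)\<^sup>2) = 1" using v k by (simp add: orthonormal_on_def power2_eq_square)
    have "bil_form I S h (v k) = bil_form I S (v k) (v k) * (\<Sum>i\<in>I. h i * v k i)"
    proof (rule rayleigh_first_order[OF Ssym])
      fix a
      define q where "q = (\<Sum>i\<in>I. (v k i + a * h i)\<^sup>2)"
      have "q = 1 + 2 * a * (\<Sum>i\<in>I. h i * v k i) + a\<^sup>2 * (\<Sum>i\<in>I. (h i)\<^sup>2)"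
        unfolding q_def vk[symmetric]
        by (simp add: power2_eq_square algebra_simps sum.distrib sum_distrib_left)
      moreover have "0 \<le> a\<^sup>2 * (\<Sum>i\<in>I. (h i)\<^sup>2)" by (simp add: sum_nonneg)
      ultimately have q: "q > 0" using h[OF k] by simp
      define r where "r = sqrt q"
      have r: "r\<^sup>2 = q" "r \<noteq> 0" using q by (auto simp: r_def)
      let ?x = "\<lambda>i. v k i + a * h i"
      let ?w = "v(k := \<lambda>i. (1 / r) * ?x i)"
      have "orthonormal_on I n ?w"
        by (rule orthonormal_on_replace[OF v k h]) (use r in \<open>auto simp: q_def\<close>)
      from Smax[OF this]
      have "bil_form I S (?w k) (?w k) \<le> bil_form I S (v k) (v k)"
        using k by (simp add: sum.remove[of "{..<n}" k])
      then have "(1 / r)\<^sup>2 * bil_form I S ?x ?x \<le> bil_form I S (v k) (v k)"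
        unfolding fun_upd_same bil_form_scale .
      then show "bil_form I S ?x ?x \<le> bil_form I S (v k) (v k) * q"
        using r q by (simp add: power_divide divide_le_eq)
    qed (simp add: vk)
    then show ?thesis using h[OF k] by simp
  qed
  ultimately show ?thesis
    using t v tpos col by (intro exI[of _ t] exI[of _ v] exI[of _ \<mu>]) auto
qed

section \<open>Orthogonal projections and trace duality in \<open>\<ell>\<^sub>1\<^sup>d\<close>\<close>

lemma vec_on_l1_space: "vec_on {..<d} y \<in> l1_space d"
  by (auto simp: l1_space_def in_keys_iff lookup_vec_on split: if_splits)

definition frame_projection :: "nat \<Rightarrow> nat \<Rightarrow> (nat \<Rightarrow> nat \<Rightarrow> real) \<Rightarrow> (nat \<Rightarrow>\<^sub>0 real) \<Rightarrow> nat \<Rightarrow>\<^sub>0 real" where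
  "frame_projection d n b x =
     (\<Sum>k<n. (\<Sum>p<d. Poly_Mapping.lookup x p * b k p) *\<^sub>R vec_on {..<d} (b k))"

definition frame_span :: "nat \<Rightarrow> nat \<Rightarrow> (nat \<Rightarrow> nat \<Rightarrow> real) \<Rightarrow> (nat \<Rightarrow>\<^sub>0 real) set" where
  "frame_span d n b = span ((\<lambda>k. vec_on {..<d} (b k)) ` {..<n})"

lemma frame_span_subset: "frame_span d n b \<subseteq> l1_space d"
  unfolding frame_span_def by (intro span_minimal subspace_l1_space) (auto simp: vec_on_l1_space)

lemma lookup_frame_projection:
  "q < d \<Longrightarrow> Poly_Mapping.lookup (frame_projection d n b x) q
     = (\<Sum>k<n. (\<Sum>p<d. Poly_Mapping.lookup x p * b k p) * b k q)"
  by (simp add: frame_projection_def lookup_sum lookup_scaleR lookup_vec_on)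

lemma frame_projection_in_span: "frame_projection d n b x \<in> frame_span d n b"
  unfolding frame_projection_def frame_span_def by (intro span_sum span_scale span_base) auto

lemma linear_frame_projection: "linear (frame_projection d n b)"
  by (rule linearI)
     (simp_all add: frame_projection_def lookup_add lookup_scaleR distrib_right sum.distrib
       scaleR_add_left scaleR_sum_right sum_distrib_left mult.assoc)

lemma frame_projection_id:
  assumes b: "orthonormal_on {..<d} n b" and x: "x \<in> frame_span d n b"
  shows "frame_projection d n b x = x"
proof -
  have "frame_projection d n b y = id y" if y: "y \<in> (\<lambda>k. vec_on {..<d} (b k)) ` {..<n}" for y
  proof -
    obtain l where l: "l < n" "y = vec_on {..<d} (b l)" using y by auto
    have "frame_projection d n b y = (\<Sum>k<n. (if k = l then 1 else 0) *\<^sub>R vec_on {..<d} (b k))"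
      unfolding frame_projection_def
    proof (intro sum.cong refl)
      fix k assume "k \<in> {..<n}"
      then have "(\<Sum>p<d. b l p * b k p) = (if k = l then 1 else 0)"
        using b l(1) by (auto simp: orthonormal_on_def)
      then show "(\<Sum>p<d. Poly_Mapping.lookup y p * b k p) *\<^sub>R vec_on {..<d} (b k)
          = (if k = l then 1 else 0) *\<^sub>R vec_on {..<d} (b k)"
        by (simp add: l(2) lookup_vec_on)
    qed
    also have "\<dots> = (\<Sum>k<n. if k = l then vec_on {..<d} (b k) else 0)"
      by (rule sum.cong) auto
    finally show ?thesis using l by simp
  qed
  from linear_eq_on_span[OF linear_frame_projection linear_id this] x
  show ?thesis by (simp add: frame_span_def)
qed

lemma frame_projection_orthogonal:
  assumes b: "orthonormal_on {..<d} n b"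
  shows "orthogonal_projection d (frame_span d n b) (frame_projection d n b)"
  unfolding orthogonal_projection_def
proof (intro ballI conjI frame_projection_in_span)
  fix x y assume y: "y \<in> frame_span d n b"
  let ?r = "x - frame_projection d n b x"
  have lin: "linear (\<lambda>y. std_inner d ?r y)"
    by (rule linearI)
       (simp_all add: std_inner_def lookup_add lookup_scaleR algebra_simps sum.distrib sum_distrib_left)
  have "std_inner d ?r z = 0" if z: "z \<in> (\<lambda>k. vec_on {..<d} (b k)) ` {..<n}" for z
  proof -
    obtain l where l: "l < n" "z = vec_on {..<d} (b l)" using z by auto
    let ?c = "\<lambda>k. \<Sum>p<d. Poly_Mapping.lookup x p * b k p"
    have "(\<Sum>q<d. Poly_Mapping.lookup (frame_projection d n b x) q * b l q)
        = (\<Sum>q<d. \<Sum>k<n. ?c k * (b k q * b l q))"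
      by (intro sum.cong refl) (simp add: lookup_frame_projection sum_distrib_right mult.assoc)
    also have "\<dots> = (\<Sum>k<n. ?c k * (\<Sum>q<d. b k q * b l q))"
      unfolding sum_distrib_left by (rule sum.swap)
    also have "\<dots> = (\<Sum>k<n. if k = l then ?c k else 0)"
      using b l(1) by (intro sum.cong refl) (auto simp: orthonormal_on_def)
    also have "\<dots> = ?c l" using l(1) by simp
    finally show ?thesis
      by (simp add: std_inner_def l(2) lookup_vec_on lookup_minus left_diff_distrib sum_subtractf)
  qed
  from linear_eq_0_on_span[OF lin this] y show "std_inner d ?r y = 0"
    by (simp add: frame_span_def)
qed

text \<open>The norm of an operator on \<open>\<ell>\<^sub>1\<^sup>d\<close> is the largest \<open>\<ell>\<^sub>1\<close>-norm of a column of its matrix.\<close>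

lemma norm_frame_projection_le:
  assumes C: "\<And>p. p < d \<Longrightarrow> (\<Sum>q<d. \<bar>gram_kernel n b p q\<bar>) \<le> C" and x: "x \<in> l1_space d"
  shows "norm (frame_projection d n b x) \<le> C * norm x"
proof -
  let ?x = "Poly_Mapping.lookup x"
  have kernel: "(\<Sum>k<n. (\<Sum>p<d. ?x p * b k p) * b k q) = (\<Sum>p<d. ?x p * gram_kernel n b p q)" for q
  proof -
    have "(\<Sum>k<n. (\<Sum>p<d. ?x p * b k p) * b k q) = (\<Sum>k<n. \<Sum>p<d. ?x p * (b k p * b k q))"
      by (simp add: sum_distrib_right mult.assoc)
    also have "\<dots> = (\<Sum>p<d. \<Sum>k<n. ?x p * (b k p * b k q))" by (rule sum.swap)
    finally show ?thesis by (simp add: gram_kernel_def sum_distrib_left)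
  qed
  have "frame_projection d n b x \<in> l1_space d"
    using frame_projection_in_span frame_span_subset by blast
  then have "norm (frame_projection d n b x) = (\<Sum>q<d. \<bar>\<Sum>k<n. (\<Sum>p<d. ?x p * b k p) * b k q\<bar>)"
    by (simp add: norm_l1_space lookup_frame_projection)
  also have "\<dots> = (\<Sum>q<d. \<bar>\<Sum>p<d. ?x p * gram_kernel n b p q\<bar>)"
    unfolding kernel ..
  also have "\<dots> \<le> (\<Sum>q<d. \<Sum>p<d. \<bar>?x p\<bar> * \<bar>gram_kernel n b p q\<bar>)"
    unfolding abs_mult[symmetric] by (intro sum_mono sum_abs)
  also have "\<dots> = (\<Sum>p<d. \<bar>?x p\<bar> * (\<Sum>q<d. \<bar>gram_kernel n b p q\<bar>))"
    unfolding sum_distrib_left by (rule sum.swap)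
  also have "\<dots> \<le> (\<Sum>p<d. \<bar>?x p\<bar> * C)"
    using C by (intro sum_mono mult_left_mono) auto
  also have "\<dots> = C * norm x"
    using x by (simp add: norm_l1_space sum_distrib_left mult.commute)
  finally show ?thesis .
qed

lemma linear_on_sum:
  assumes "linear_on V f" "subspace V" "finite A" "\<And>i. i \<in> A \<Longrightarrow> x i \<in> V"
  shows "f (\<Sum>i\<in>A. c i *\<^sub>R x i) = (\<Sum>i\<in>A. c i *\<^sub>R f (x i))"
  using assms(3,4)
proof (induction A)
  case empty
  have "f (0 *\<^sub>R 0) = 0 *\<^sub>R f 0" using assms(1,2) subspace_0 unfolding linear_on_def by blast
  then show ?case by simp
next
  case (insert i A)
  have "c i *\<^sub>R x i \<in> V" "(\<Sum>i\<in>A. c i *\<^sub>R x i) \<in> V"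
    using insert.prems assms(2) by (auto intro!: subspace_sum subspace_scale)
  then have "f (c i *\<^sub>R x i + (\<Sum>i\<in>A. c i *\<^sub>R x i)) = c i *\<^sub>R f (x i) + f (\<Sum>i\<in>A. c i *\<^sub>R x i)"
    using assms(1) insert.prems unfolding linear_on_def by auto
  then show ?case using insert by simp
qed

text \<open>Trace duality. The hypothesis on \<open>W\<close> says that the span of \<open>b\<close> is invariant under \<open>W\<close>, so the trace of
  the product of \<open>W\<close> with a projection onto this span does not depend on the projection. For the
  orthogonal one it is the left-hand side. For \<open>Q\<close> it is at most \<open>w\<close> times the sum of the absolute
  values of all entries of \<open>Q\<close>, and each of the \<open>d\<close> columns contributes at most the norm of
  \<open>Q\<close>.\<close>

lemma projection_norm_lower_bound:
  assumes b: "orthonormal_on {..<d} n b" and Q: "bounded_projection (frame_span d n b) (l1_space d) Q"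
    and W: "\<And>p q. p < d \<Longrightarrow> q < d \<Longrightarrow> \<bar>W p q\<bar> \<le> w" and w: "0 \<le> w"
    and crit: "\<And>k h. k < n \<Longrightarrow> (\<And>l. l < n \<Longrightarrow> (\<Sum>p<d. h p * b l p) = 0) \<Longrightarrow> bil_form {..<d} W h (b k) = 0"
  shows "(\<Sum>k<n. bil_form {..<d} W (b k) (b k)) \<le> w * d * op_norm_on (l1_space d) Q"
proof -
  let ?e = "\<lambda>p. Poly_Mapping.single p (1::real)"
  define c where "c = op_norm_on (l1_space d) Q"
  define r where "r p q = Poly_Mapping.lookup (Q (?e p)) q" for p q
  define a where "a k p = (\<Sum>q<d. r p q * b k q)" for k p
  have e: "?e p \<in> l1_space d" if "p < d" for p using that by (simp add: l1_space_def)
  have QE: "Q (?e p) \<in> frame_span d n b" if "p < d" for p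
    using Q e[OF that] unfolding bounded_projection_def by blast
  have row: "(\<Sum>q<d. \<bar>r p q\<bar>) \<le> c" if p: "p < d" for p
  proof -
    have "norm (?e p) = 1"
      using p by (simp add: norm_l1_space[OF e[OF p]] lookup_single when_def if_distrib cong: if_cong)
    moreover have "norm (Q (?e p)) = (\<Sum>q<d. \<bar>r p q\<bar>)"
      using norm_l1_space[of "Q (?e p)" d] QE[OF p] frame_span_subset by (auto simp: r_def)
    ultimately show ?thesis using norm_le_op_norm_on[OF Q e[OF p]] by (simp add: c_def)
  qed
  \<comment> \<open>The columns of \<open>Q\<close> lie in the span of the orthonormal vectors, with coefficients \<open>a k p\<close>.\<close>
  have rexp: "r p q = (\<Sum>k<n. a k p * b k q)" if "p < d" "q < d" for p q
    using arg_cong[OF frame_projection_id[OF b QE[OF that(1)]], of "\<lambda>x. Poly_Mapping.lookup x q"]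
      lookup_frame_projection[OF that(2), of n b "Q (?e p)"]
    by (simp add: r_def a_def)
  have fix_b: "(\<Sum>p<d. b l p * r p q) = b l q" if "l < n" "q < d" for l q
  proof -
    let ?u = "vec_on {..<d} (b l)"
    have "?u \<in> frame_span d n b" unfolding frame_span_def using that by (intro span_base) auto
    then have "Q ?u = ?u" using Q unfolding bounded_projection_def by blast
    moreover have "Q ?u = (\<Sum>p<d. b l p *\<^sub>R Q (?e p))"
      unfolding vec_on_def using Q e unfolding bounded_projection_def
      by (intro linear_on_sum[OF _ subspace_l1_space]) auto
    ultimately have "Poly_Mapping.lookup (\<Sum>p<d. b l p *\<^sub>R Q (?e p)) q = b l q"
      using that by (simp add: lookup_vec_on)
    then show ?thesis by (simp add: lookup_sum lookup_scaleR r_def)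
  qed
  \<comment> \<open>Since \<open>Q\<close> fixes the span, \<open>a\<close> is biorthogonal to \<open>b\<close>, and \<open>a k - b k\<close> is orthogonal to the span.\<close>
  have ab: "(\<Sum>p<d. a k p * b l p) = (if k = l then 1 else 0)" if "k < n" "l < n" for k l
  proof -
    have "(\<Sum>p<d. a k p * b l p) = (\<Sum>p<d. \<Sum>q<d. b k q * (b l p * r p q))"
      unfolding a_def sum_distrib_right by (intro sum.cong refl) (simp only: mult_ac)
    also have "\<dots> = (\<Sum>q<d. \<Sum>p<d. b k q * (b l p * r p q))" by (rule sum.swap)
    also have "\<dots> = (\<Sum>q<d. b k q * b l q)"
      using fix_b[OF that(2)] by (simp add: sum_distrib_left[symmetric])
    finally show ?thesis using b that by (simp add: orthonormal_on_def)
  qed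
  have "bil_form {..<d} W (a k) (b k) = bil_form {..<d} W (b k) (b k)" if k: "k < n" for k
  proof -
    have "bil_form {..<d} W (\<lambda>p. a k p - b k p) (b k) = 0"
    proof (rule crit[OF k])
      fix l assume "l < n"
      then show "(\<Sum>p<d. (a k p - b k p) * b l p) = 0"
        using ab[OF k] b k by (simp add: left_diff_distrib sum_subtractf orthonormal_on_def)
    qed
    then show ?thesis by (simp add: bil_form_def left_diff_distrib sum_subtractf)
  qed
  then have "(\<Sum>k<n. bil_form {..<d} W (b k) (b k)) = (\<Sum>k<n. bil_form {..<d} W (a k) (b k))"
    by simp
  also have "\<dots> = (\<Sum>p<d. \<Sum>k<n. \<Sum>q<d. a k p * b k q * W p q)"
    unfolding bil_form_def by (rule sum.swap)
  also have "\<dots> = (\<Sum>p<d. \<Sum>q<d. \<Sum>k<n. a k p * b k q * W p q)"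
    by (intro sum.cong refl sum.swap)
  also have "\<dots> = (\<Sum>p<d. \<Sum>q<d. r p q * W p q)"
    by (intro sum.cong refl) (simp add: rexp sum_distrib_right)
  also have "\<dots> \<le> (\<Sum>p<d. \<Sum>q<d. \<bar>r p q\<bar> * w)"
  proof (intro sum_mono)
    fix p q assume "p \<in> {..<d}" "q \<in> {..<d}"
    then have "\<bar>r p q\<bar> * \<bar>W p q\<bar> \<le> \<bar>r p q\<bar> * w" by (intro mult_left_mono W) auto
    then show "r p q * W p q \<le> \<bar>r p q\<bar> * w" unfolding abs_mult[symmetric] by linarith
  qed
  also have "\<dots> \<le> (\<Sum>p<d. c * w)"
    unfolding sum_distrib_right[symmetric] using row w by (intro sum_mono mult_right_mono) auto
  finally show ?thesis by (simp add: c_def mult_ac)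
qed

section \<open>Replacing weights by repeated coordinates\<close>

text \<open>The index set \<open>{..<d}\<close> is cut into blocks, with \<open>m i\<close> indices for each \<open>i\<close>. The statement keeps
  only the map from an index to its block and the resulting rule for sums.\<close>

lemma blow_up_map_exists:
  fixes m :: "nat \<Rightarrow> nat"
  assumes I: "finite I" and d: "d = (\<Sum>i\<in>I. m i)"
  shows "\<exists>\<pi>. (\<forall>p<d. \<pi> p \<in> I) \<and> (\<forall>f :: nat \<Rightarrow> real. (\<Sum>p<d. f (\<pi> p)) = (\<Sum>i\<in>I. m i * f i))"
proof -
  let ?M = "Sigma I (\<lambda>i. {..<m i})"
  have fin: "finite ?M" using I by auto
  have card: "card ?M = d" using I by (simp add: d)
  obtain h where h: "bij_betw h {0..<d} ?M"
    using ex_bij_betw_nat_finite[OF fin] card by auto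
  have "fst (h p) \<in> I" if "p < d" for p
  proof -
    have "h p \<in> ?M" using bij_betwE[OF h] that by auto
    then show ?thesis by auto
  qed
  moreover have "(\<Sum>p<d. f (fst (h p))) = (\<Sum>i\<in>I. m i * f i)" for f :: "nat \<Rightarrow> real"
  proof -
    have "(\<Sum>p<d. f (fst (h p))) = (\<Sum>x\<in>?M. f (fst x))"
      using sum.reindex_bij_betw[OF h, of "\<lambda>x. f (fst x)"] by (simp add: lessThan_atLeast0)
    also have "\<dots> = (\<Sum>i\<in>I. \<Sum>a<m i. f i)"
      using I by (subst sum.Sigma) (auto simp: case_prod_beta)
    finally show ?thesis by simp
  qed
  ultimately show ?thesis by (intro exI[of _ "\<lambda>p. fst (h p)"]) auto
qed

lemma sum_fibres:
  fixes h :: "nat \<Rightarrow> real"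
  assumes "finite I" "\<And>p. p < d \<Longrightarrow> \<pi> p \<in> I"
  shows "(\<Sum>p<d. h p * f (\<pi> p)) = (\<Sum>i\<in>I. (\<Sum>p | p < d \<and> \<pi> p = i. h p) * f i)"
proof -
  have "(\<Sum>i\<in>I. \<Sum>p\<in>{p \<in> {..<d}. \<pi> p = i}. h p * f (\<pi> p)) = (\<Sum>p<d. h p * f (\<pi> p))"
    using assms by (intro sum.group) auto
  moreover have "(\<Sum>p\<in>{p \<in> {..<d}. \<pi> p = i}. h p * f (\<pi> p)) = (\<Sum>p | p < d \<and> \<pi> p = i. h p) * f i" for i
    by (auto simp: sum_distrib_right intro!: sum.cong)
  ultimately show ?thesis by simp
qed

text \<open>The multiplicities are \<open>m i = \<lceil>M (t i)\<^sup>2\<rceil>\<close> and \<open>R = \<surd>M\<close>. The rounding error is at most \<open>1\<close>, which is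
  a small fraction of \<open>M (t i)\<^sup>2\<close> once \<open>M\<close> is large.\<close>

lemma integers_near_scaled_squares:
  fixes t :: "nat \<Rightarrow> real"
  assumes I: "finite I" and t: "\<And>i. i \<in> I \<Longrightarrow> 0 < t i" and \<rho>: "1 < \<rho>"
  shows "\<exists>(m :: nat \<Rightarrow> nat) R. 0 < R \<and> (\<forall>i\<in>I. (1::nat) \<le> m i \<and> R * t i \<le> sqrt (m i) \<and> sqrt (m i) \<le> \<rho> * (R * t i))"
proof -
  define M where "M = 1 + (\<Sum>i\<in>I. 1 / ((\<rho> - 1) * (t i)\<^sup>2))"
  have nn: "0 \<le> 1 / ((\<rho> - 1) * (t i)\<^sup>2)" for i using \<rho> by simp
  have M: "1 \<le> M" unfolding M_def using nn by (simp add: sum_nonneg)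
  have Mt: "1 \<le> (\<rho> - 1) * (M * (t i)\<^sup>2)" if i: "i \<in> I" for i
  proof -
    have "1 / ((\<rho> - 1) * (t i)\<^sup>2) \<le> (\<Sum>i\<in>I. 1 / ((\<rho> - 1) * (t i)\<^sup>2))"
      using I i nn by (intro member_le_sum) auto
    then have "1 / ((\<rho> - 1) * (t i)\<^sup>2) \<le> M" by (simp add: M_def)
    then show ?thesis using \<rho> t[OF i] by (simp add: divide_le_eq mult_ac)
  qed
  define m where "m i = nat \<lceil>M * (t i)\<^sup>2\<rceil>" for i
  have "(1::nat) \<le> m i \<and> sqrt M * t i \<le> sqrt (m i) \<and> sqrt (m i) \<le> \<rho> * (sqrt M * t i)" if i: "i \<in> I" for i
  proof -
    have pos: "0 < M * (t i)\<^sup>2" using M t[OF i] by simp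
    have lo: "M * (t i)\<^sup>2 \<le> m i" unfolding m_def by linarith
    have hi: "m i \<le> M * (t i)\<^sup>2 + 1" unfolding m_def using pos by linarith
    have eq: "sqrt M * t i = sqrt (M * (t i)\<^sup>2)" using t[OF i] by (simp add: real_sqrt_mult)
    have "m i \<le> M * (t i)\<^sup>2 + (\<rho> - 1) * (M * (t i)\<^sup>2)" using hi Mt[OF i] by linarith
    also have "\<dots> = \<rho> * (M * (t i)\<^sup>2)" by (simp add: algebra_simps)
    also have "\<dots> \<le> \<rho>\<^sup>2 * (M * (t i)\<^sup>2)"
      using pos \<rho> by (intro mult_right_mono) (auto simp: power2_eq_square)
    finally have "sqrt (m i) \<le> sqrt (\<rho>\<^sup>2 * (M * (t i)\<^sup>2))" by simp
    then have "sqrt (m i) \<le> \<rho> * (sqrt M * t i)" unfolding eq using \<rho> by (simp add: real_sqrt_mult)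
    moreover have "sqrt M * t i \<le> sqrt (m i)" unfolding eq using lo by simp
    moreover have "0 < real (m i)" using pos lo by linarith
    then have "(1::nat) \<le> m i" by simp
    ultimately show ?thesis by blast
  qed
  moreover have "0 < sqrt M" using M by simp
  ultimately show ?thesis by blast
qed

text \<open>Coordinate \<open>i\<close> is repeated \<open>m i\<close> times and the entries \<open>v\<^sub>k(i)\<close> are divided by \<open>\<surd>(m i)\<close>, which
  keeps orthonormality. Since \<open>\<surd>(m i)\<close> is proportional to \<open>t i\<close> up to the factor \<open>\<rho>\<close>, the
  weighted column sums \<open>\<Sum>\<^sub>j t\<^sub>j \<bar>K\<^sub>i\<^sub>j\<bar> / t\<^sub>i \<le> \<mu>\<close> become plain column sums of the new kernel. The matrix
  \<open>S\<^sub>i\<^sub>j = t\<^sub>i t\<^sub>j sgn K\<^sub>i\<^sub>j\<close> becomes \<open>W\<close>, whose entries are bounded by \<open>1 / R\<^sup>2\<close>, and the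
  span of the new vectors is again invariant under it; trace duality gives the lower bound for all
  projections. The factor \<open>\<rho>\<^sup>2\<close> there is the bound for \<open>d / R\<^sup>2\<close>.\<close>

lemma blow_up_extremal_pair:
  assumes I: "finite I" and t: "unit_weight I t" "\<And>i. i \<in> I \<Longrightarrow> 0 < t i" and v: "orthonormal_on I n v"
    and col: "\<And>i. i \<in> I \<Longrightarrow> (\<Sum>j\<in>I. t j * \<bar>gram_kernel n v i j\<bar>) \<le> \<mu> * t i"
    and crit: "\<And>k h. k < n \<Longrightarrow> (\<And>l. l < n \<Longrightarrow> (\<Sum>i\<in>I. h i * v l i) = 0) \<Longrightarrow>
                 bil_form I (\<lambda>i j. t i * t j * sgn (gram_kernel n v i j)) h (v k) = 0"
    and \<rho>: "1 < \<rho>"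
  shows "\<exists>d b. 1 \<le> d \<and> orthonormal_on {..<d} n b \<and>
           (\<forall>p<d. (\<Sum>q<d. \<bar>gram_kernel n b p q\<bar>) \<le> \<rho> * \<mu>) \<and>
           (\<forall>Q. bounded_projection (frame_span d n b) (l1_space d) Q \<longrightarrow>
              weighted_kernel_sum I n t v \<le> \<rho>\<^sup>2 * op_norm_on (l1_space d) Q)"
proof -
  have "I \<noteq> {}" using t(1) by (auto simp: unit_weight_def)
  then obtain i0 where i0: "i0 \<in> I" by blast
  have "\<exists>(m :: nat \<Rightarrow> nat) R. 0 < R \<and>
      (\<forall>i\<in>I. (1::nat) \<le> m i \<and> R * t i \<le> sqrt (m i) \<and> sqrt (m i) \<le> \<rho> * (R * t i))"
    by (rule integers_near_scaled_squares[OF I _ \<rho>]) (rule t(2))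
  then obtain m :: "nat \<Rightarrow> nat" and R where R: "0 < R" and mR:
      "\<forall>i\<in>I. (1::nat) \<le> m i \<and> R * t i \<le> sqrt (m i) \<and> sqrt (m i) \<le> \<rho> * (R * t i)"
    by (elim exE conjE)
  then have m: "\<And>i. i \<in> I \<Longrightarrow> (1::nat) \<le> m i" "\<And>i. i \<in> I \<Longrightarrow> R * t i \<le> sqrt (m i)"
      "\<And>i. i \<in> I \<Longrightarrow> sqrt (m i) \<le> \<rho> * (R * t i)"
    by blast+
  define d where "d = (\<Sum>i\<in>I. m i)"
  obtain \<pi> where \<pi>: "\<And>p. p < d \<Longrightarrow> \<pi> p \<in> I"
    "\<And>f :: nat \<Rightarrow> real. (\<Sum>p<d. f (\<pi> p)) = (\<Sum>i\<in>I. m i * f i)"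
    using blow_up_map_exists[OF I d_def] by blast
  define s where "s i = sqrt (m i)" for i
  have s: "0 < s i" "s i * s i = m i" if "i \<in> I" for i using m(1)[OF that] by (auto simp: s_def)
  define b where "b k p = v k (\<pi> p) / s (\<pi> p)" for k p
  let ?K = "gram_kernel n v"
  have Kb: "gram_kernel n b p q = ?K (\<pi> p) (\<pi> q) / (s (\<pi> p) * s (\<pi> q))" for p q
    by (simp add: gram_kernel_def b_def sum_divide_distrib)
  have d1: "1 \<le> d"
    using m(1)[OF i0] member_le_sum[of i0 I m] i0 I unfolding d_def by fastforce
  have orth: "orthonormal_on {..<d} n b"
  proof -
    have "(\<Sum>p<d. b k p * b l p) = (\<Sum>i\<in>I. v k i * v l i)" for k l
    proof -
      have "(\<Sum>p<d. b k p * b l p) = (\<Sum>i\<in>I. m i * (v k i / s i * (v l i / s i)))"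
        unfolding b_def by (rule \<pi>(2))
      also have "\<dots> = (\<Sum>i\<in>I. v k i * v l i)"
      proof (rule sum.cong)
        fix i assume i: "i \<in> I"
        show "m i * (v k i / s i * (v l i / s i)) = v k i * v l i"
          unfolding s(2)[OF i, symmetric] using s(1)[OF i] by simp
      qed simp
      finally show ?thesis .
    qed
    then show ?thesis using v by (simp add: orthonormal_on_def)
  qed
  have \<mu>0: "0 \<le> \<mu>"
  proof -
    have "0 \<le> (\<Sum>j\<in>I. t j * \<bar>?K i0 j\<bar>)" using t(2) by (intro sum_nonneg) (simp add: less_imp_le)
    then have "0 \<le> \<mu> * t i0" using col[OF i0] by linarith
    then show ?thesis using t(2)[OF i0] by (simp add: zero_le_mult_iff)
  qed
  have colb: "(\<Sum>q<d. \<bar>gram_kernel n b p q\<bar>) \<le> \<rho> * \<mu>" if p: "p < d" for p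
  proof -
    define i where "i = \<pi> p"
    have i: "i \<in> I" using \<pi>(1)[OF p] by (simp add: i_def)
    have "(\<Sum>q<d. \<bar>gram_kernel n b p q\<bar>) = (\<Sum>j\<in>I. m j * \<bar>?K i j / (s i * s j)\<bar>)"
      unfolding Kb i_def by (rule \<pi>(2))
    also have "\<dots> = (\<Sum>j\<in>I. s j * \<bar>?K i j\<bar>) / s i"
      unfolding sum_divide_distrib
    proof (rule sum.cong)
      fix j assume j: "j \<in> I"
      show "m j * \<bar>?K i j / (s i * s j)\<bar> = s j * \<bar>?K i j\<bar> / s i"
        unfolding s(2)[OF j, symmetric] using s(1)[OF i] s(1)[OF j] by (simp add: abs_mult)
    qed simp
    also have "\<dots> \<le> (\<Sum>j\<in>I. \<rho> * R * (t j * \<bar>?K i j\<bar>)) / s i"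
    proof (intro divide_right_mono sum_mono)
      fix j assume j: "j \<in> I"
      have "s j * \<bar>?K i j\<bar> \<le> (\<rho> * (R * t j)) * \<bar>?K i j\<bar>"
        using m(3)[OF j] by (intro mult_right_mono) (auto simp: s_def)
      then show "s j * \<bar>?K i j\<bar> \<le> \<rho> * R * (t j * \<bar>?K i j\<bar>)" by (simp add: mult.assoc)
    qed (use s(1)[OF i] in simp)
    also have "\<dots> \<le> (\<rho> * R * (\<mu> * t i)) / s i"
      unfolding sum_distrib_left[symmetric] using col[OF i] \<rho> R s(1)[OF i]
      by (intro divide_right_mono mult_left_mono) auto
    also have "\<dots> = \<rho> * \<mu> * (R * t i) / s i" by simp
    also have "\<dots> \<le> \<rho> * \<mu> * s i / s i"
      using m(2)[OF i] \<mu>0 \<rho> s(1)[OF i] by (intro divide_right_mono mult_left_mono) (auto simp: s_def)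
    finally show ?thesis using s(1)[OF i] by simp
  qed
  define S where "S i j = t i * t j * sgn (?K i j)" for i j
  define W where "W p q = S (\<pi> p) (\<pi> q) / (s (\<pi> p) * s (\<pi> q))" for p q
  have Wle: "\<bar>W p q\<bar> \<le> 1 / R\<^sup>2" if pq: "p < d" "q < d" for p q
  proof -
    have ts: "0 \<le> t i / s i" "t i / s i \<le> 1 / R" if i: "i \<in> I" for i
      using m(2)[OF i] s(1)[OF i] R t(2)[OF i] by (auto simp: s_def field_simps)
    note ip = ts[OF \<pi>(1)[OF pq(1)]] and iq = ts[OF \<pi>(1)[OF pq(2)]]
    have "W p q = (t (\<pi> p) / s (\<pi> p)) * (t (\<pi> q) / s (\<pi> q)) * sgn (?K (\<pi> p) (\<pi> q))"
      by (simp add: W_def S_def)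
    then have "\<bar>W p q\<bar> = (t (\<pi> p) / s (\<pi> p)) * (t (\<pi> q) / s (\<pi> q)) * \<bar>sgn (?K (\<pi> p) (\<pi> q))\<bar>"
      using ip(1) iq(1) by (simp only: abs_mult abs_of_nonneg)
    also have "\<dots> \<le> (t (\<pi> p) / s (\<pi> p)) * (t (\<pi> q) / s (\<pi> q)) * 1"
      using ip(1) iq(1) by (intro mult_left_mono mult_nonneg_nonneg) (auto simp: abs_sgn_eq)
    also have "\<dots> \<le> 1 / R * (1 / R)"
      using ip iq R by (simp add: mult_mono del: times_divide_eq_left times_divide_eq_right)
    finally show ?thesis by (simp add: power2_eq_square)
  qed
  have Wcrit: "bil_form {..<d} W h (b k) = 0"
    if k: "k < n" and h: "\<And>l. l < n \<Longrightarrow> (\<Sum>p<d. h p * b l p) = 0" for h k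
  proof -
    \<comment> \<open>The block sums of \<open>h\<close>: they carry the orthogonality and the quadratic form back to \<open>I\<close>.\<close>
    define x where "x i = (\<Sum>p | p < d \<and> \<pi> p = i. h p / s (\<pi> p))" for i
    have "(\<Sum>i\<in>I. x i * v l i) = 0" if l: "l < n" for l
    proof -
      have "(\<Sum>i\<in>I. x i * v l i) = (\<Sum>p<d. h p / s (\<pi> p) * v l (\<pi> p))"
        unfolding x_def by (rule sum_fibres[OF I \<pi>(1), symmetric])
      then show ?thesis using h[OF l] by (simp add: b_def)
    qed
    then have "bil_form I S x (v k) = 0" unfolding S_def by (intro crit[OF k])
    moreover have "bil_form {..<d} W h (b k) = bil_form I S x (v k)"
    proof -
      have "(\<Sum>q<d. h p * b k q * W p q) = h p / s (\<pi> p) * (\<Sum>j\<in>I. v k j * S (\<pi> p) j)" for p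
      proof -
        have "(\<Sum>q<d. h p * b k q * W p q)
            = (\<Sum>j\<in>I. m j * (h p * (v k j / s j) * (S (\<pi> p) j / (s (\<pi> p) * s j))))"
          unfolding b_def W_def by (rule \<pi>(2))
        also have "\<dots> = (\<Sum>j\<in>I. h p / s (\<pi> p) * (v k j * S (\<pi> p) j))"
        proof (rule sum.cong)
          fix j assume j: "j \<in> I"
          show "m j * (h p * (v k j / s j) * (S (\<pi> p) j / (s (\<pi> p) * s j)))
              = h p / s (\<pi> p) * (v k j * S (\<pi> p) j)"
            unfolding s(2)[OF j, symmetric] using s(1)[OF j] by simp
        qed simp
        finally show ?thesis by (simp add: sum_distrib_left)
      qed
      then have "bil_form {..<d} W h (b k) = (\<Sum>p<d. h p / s (\<pi> p) * (\<Sum>j\<in>I. v k j * S (\<pi> p) j))"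
        by (simp add: bil_form_def)
      also have "\<dots> = (\<Sum>i\<in>I. x i * (\<Sum>j\<in>I. v k j * S i j))"
        unfolding x_def by (rule sum_fibres[OF I \<pi>(1)])
      finally show ?thesis by (simp add: bil_form_def sum_distrib_left mult.assoc)
    qed
    ultimately show ?thesis by simp
  qed
  have trace: "(\<Sum>k<n. bil_form {..<d} W (b k) (b k)) = weighted_kernel_sum I n t v"
  proof -
    have "(\<Sum>k<n. bil_form {..<d} W (b k) (b k)) = (\<Sum>p<d. \<Sum>q<d. W p q * gram_kernel n b p q)"
      by (rule sum_bil_form_eq)
    also have "\<dots> = (\<Sum>p<d. \<Sum>j\<in>I. m j * (S (\<pi> p) j / (s (\<pi> p) * s j) * (?K (\<pi> p) j / (s (\<pi> p) * s j))))"
      unfolding W_def Kb by (rule sum.cong[OF refl]) (rule \<pi>(2))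
    also have "\<dots> = (\<Sum>i\<in>I. m i * (\<Sum>j\<in>I. m j * (S i j / (s i * s j) * (?K i j / (s i * s j)))))"
      by (rule \<pi>(2))
    also have "\<dots> = (\<Sum>i\<in>I. \<Sum>j\<in>I. t i * t j * \<bar>?K i j\<bar>)"
      unfolding sum_distrib_left
    proof (intro sum.cong refl)
      fix i j assume ij: "i \<in> I" "j \<in> I"
      have "m i * (m j * (S i j / (s i * s j) * (?K i j / (s i * s j)))) = S i j * ?K i j"
        unfolding s(2)[OF ij(1), symmetric] s(2)[OF ij(2), symmetric]
        using s(1)[OF ij(1)] s(1)[OF ij(2)] by simp
      also have "\<dots> = t i * t j * \<bar>?K i j\<bar>" by (simp add: S_def mult.assoc abs_sgn mult.commute)
      finally show "m i * (m j * (S i j / (s i * s j) * (?K i j / (s i * s j)))) = t i * t j * \<bar>?K i j\<bar>" .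
    qed
    finally show ?thesis by (simp add: weighted_kernel_sum_def)
  qed
  have dR: "real d \<le> \<rho>\<^sup>2 * R\<^sup>2"
  proof -
    have "real d = (\<Sum>i\<in>I. s i * s i)" using s(2) by (simp add: d_def)
    also have "\<dots> \<le> (\<Sum>i\<in>I. (\<rho> * (R * t i)) * (\<rho> * (R * t i)))"
    proof (intro sum_mono mult_mono)
      fix i assume i: "i \<in> I"
      show "s i \<le> \<rho> * (R * t i)" "s i \<le> \<rho> * (R * t i)" using m(3)[OF i] by (auto simp: s_def)
      show "0 \<le> s i" using s(1)[OF i] by simp
      show "0 \<le> \<rho> * (R * t i)" using \<rho> R t(2)[OF i] by simp
    qed
    also have "\<dots> = \<rho>\<^sup>2 * R\<^sup>2 * (\<Sum>i\<in>I. (t i)\<^sup>2)"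
      by (simp add: sum_distrib_left power2_eq_square mult_ac)
    finally show ?thesis using t(1) by (simp add: unit_weight_def)
  qed
  have lower: "weighted_kernel_sum I n t v \<le> \<rho>\<^sup>2 * op_norm_on (l1_space d) Q"
    if Q: "bounded_projection (frame_span d n b) (l1_space d) Q" for Q
  proof -
    have "0 \<le> op_norm_on (l1_space d) Q"
      using op_norm_on_nonneg[OF Q] subspace_0[OF subspace_l1_space] by blast
    have "weighted_kernel_sum I n t v \<le> 1 / R\<^sup>2 * d * op_norm_on (l1_space d) Q"
      unfolding trace[symmetric]
    proof (rule projection_norm_lower_bound[OF orth Q])
      show "\<bar>W p q\<bar> \<le> 1 / R\<^sup>2" if "p < d" "q < d" for p q using that by (rule Wle)
      show "bil_form {..<d} W h (b k) = 0"
        if "k < n" "\<And>l. l < n \<Longrightarrow> (\<Sum>p<d. h p * b l p) = 0" for k h using that by (rule Wcrit)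
    qed simp
    also have "\<dots> \<le> \<rho>\<^sup>2 * op_norm_on (l1_space d) Q"
    proof (rule mult_right_mono)
      show "1 / R\<^sup>2 * d \<le> \<rho>\<^sup>2" using dR R by (simp add: field_simps)
    qed fact
    finally show ?thesis .
  qed
  show ?thesis using d1 orth colb lower by (intro exI[of _ d] exI[of _ b]) simp
qed

section \<open>Almost minimal orthogonal projections of almost maximal norm\<close>

theorem theorem1p2:
  fixes n :: nat and \<epsilon> :: real
  assumes "n \<ge> 1" and "\<epsilon> > 0"
  shows "\<exists>d E P. d \<ge> 1 \<and> subspace E \<and> E \<subseteq> l1_space d \<and> dim E = n \<and>
           orthogonal_projection d E P \<and>
           max_proj_const n - \<epsilon> \<le> op_norm_on (l1_space d) P \<and>
           op_norm_on (l1_space d) P \<le> rel_proj_const E (l1_space d) + \<epsilon>"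
proof -
  define \<gamma> where "\<gamma> = \<epsilon> / 4"
  have \<gamma>: "\<gamma> > 0" using assms(2) by (simp add: \<gamma>_def)
  let ?X = "{weighted_kernel_sum I n t v | I t v. finite I \<and> unit_weight I t \<and> orthonormal_on I n v}"
  have "unit_weight {..<n} (\<lambda>i. if i = 0 then 1 else 0)"
  proof -
    have "(\<Sum>i<n. (if i = 0 then 1 else 0::real)\<^sup>2) = (\<Sum>i<n. if i = 0 then 1 else 0)"
      by (rule sum.cong) auto
    then show ?thesis using assms(1) by (simp add: unit_weight_def)
  qed
  then have "?X \<noteq> {}" using orthonormal_on_standard[of n] finite_lessThan[of n] by blast
  moreover have "extremal_value n - \<gamma> < Sup ?X" using \<gamma> by (simp add: extremal_value_def)
  ultimately obtain x where x: "x \<in> ?X" "extremal_value n - \<gamma> < x"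
    by (elim less_cSupE)
  from x(1) obtain I t0 v0 where I: "finite I" and 0: "unit_weight I t0" "orthonormal_on I n v0"
    and x0: "x = weighted_kernel_sum I n t0 v0" by (elim CollectE exE conjE)
  obtain t v \<mu> where t: "unit_weight I t" "\<forall>i\<in>I. 0 < t i" and v: "orthonormal_on I n v"
    and col: "\<forall>i\<in>I. (\<Sum>j\<in>I. t j * \<bar>gram_kernel n v i j\<bar>) \<le> \<mu> * t i"
    and \<mu>: "weighted_kernel_sum I n t0 v0 \<le> \<mu>" "\<mu> - \<gamma> \<le> weighted_kernel_sum I n t v"
    and crit: "\<forall>k<n. \<forall>h. (\<forall>l<n. (\<Sum>i\<in>I. h i * v l i) = 0) \<longrightarrow>
              bil_form I (\<lambda>i j. t i * t j * sgn (gram_kernel n v i j)) h (v k) = 0"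
    using extremal_pair[OF I 0 \<gamma>] by (elim exE conjE)
  define \<Phi> where "\<Phi> = weighted_kernel_sum I n t v"
  define a where "a = real n + \<gamma>"
  \<comment> \<open>Chosen so that replacing \<open>1 + \<delta>\<close> by \<open>1\<close> in both estimates of the blow-up costs at most \<open>\<gamma>\<close> in total.\<close>
  define \<delta> where "\<delta> = \<gamma> / (3 * a)"
  have a: "0 < a" "\<Phi> \<le> a" "\<mu> \<le> a"
    using \<gamma> weighted_kernel_sum_le[OF I t(1) v] \<mu>(2) by (auto simp: a_def \<Phi>_def)
  have \<delta>: "0 < \<delta>" "3 * (\<delta> * a) = \<gamma>" using a(1) \<gamma> by (auto simp: \<delta>_def)
  obtain d b where d: "1 \<le> d" and b: "orthonormal_on {..<d} n b"
    and colb: "\<forall>p<d. (\<Sum>q<d. \<bar>gram_kernel n b p q\<bar>) \<le> (1 + \<delta>) * \<mu>"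
    and low: "\<forall>Q. bounded_projection (frame_span d n b) (l1_space d) Q \<longrightarrow>
              \<Phi> \<le> (1 + \<delta>)\<^sup>2 * op_norm_on (l1_space d) Q"
    using blow_up_extremal_pair[OF I t(1) _ v, of \<mu> "1 + \<delta>"] t(2) col crit \<delta>(1) unfolding \<Phi>_def by auto
  let ?E = "frame_span d n b" and ?P = "frame_projection d n b" and ?F = "l1_space d"
  have nP: "norm (?P x) \<le> (1 + \<delta>) * \<mu> * norm x" if "x \<in> ?F" for x
    using norm_frame_projection_le[OF _ that] colb by blast
  have P: "bounded_projection ?E ?F ?P"
    unfolding bounded_projection_def linear_on_def
    using nP frame_projection_in_span frame_projection_id[OF b]
      linear_add[OF linear_frame_projection] linear_scale[OF linear_frame_projection] by blast
  have lowQ: "\<Phi> - 2 * (\<delta> * a) \<le> op_norm_on ?F Q" if Q: "bounded_projection ?E ?F Q" for Q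
  proof -
    have "(1 + \<delta>)\<^sup>2 * (\<Phi> - 2 * (\<delta> * a))
        = \<Phi> + (2 * \<delta> + \<delta>\<^sup>2) * (\<Phi> - a) - 3 * (\<delta>\<^sup>2 * a) - 2 * (\<delta>\<^sup>2 * (\<delta> * a))"
      by (simp add: power2_eq_square algebra_simps)
    also have "\<dots> \<le> \<Phi>"
    proof -
      have "(2 * \<delta> + \<delta>\<^sup>2) * (\<Phi> - a) \<le> 0" using \<delta>(1) a(2) by (intro mult_nonneg_nonpos) auto
      moreover have "0 \<le> \<delta>\<^sup>2 * a" "0 \<le> \<delta>\<^sup>2 * (\<delta> * a)" using \<delta>(1) a(1) by simp_all
      ultimately show ?thesis by linarith
    qed
    also have "\<dots> \<le> (1 + \<delta>)\<^sup>2 * op_norm_on ?F Q" using low Q by blast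
    finally show ?thesis using \<delta>(1) by (simp add: mult_le_cancel_left_pos)
  qed
  have "\<Phi> - 2 * (\<delta> * a) \<le> rel_proj_const ?E ?F"
    unfolding rel_proj_const_def using P lowQ by (intro cInf_greatest) auto
  moreover have "op_norm_on ?F ?P \<le> (1 + \<delta>) * \<mu>"
  proof (rule rel_proj_const_le(1)[OF P _ _ nP])
    show "0 \<in> ?F" by (rule subspace_0[OF subspace_l1_space])
    have "0 \<le> (\<Sum>q<d. \<bar>gram_kernel n b 0 q\<bar>)" by (simp add: sum_nonneg)
    also have "\<dots> \<le> (1 + \<delta>) * \<mu>" using colb d by simp
    finally show "0 \<le> (1 + \<delta>) * \<mu>" .
  qed
  moreover have "(1 + \<delta>) * \<mu> \<le> \<mu> + \<delta> * a"
    using a(3) \<delta>(1) by (simp add: distrib_right)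
  ultimately have "op_norm_on ?F ?P \<le> rel_proj_const ?E ?F + \<epsilon>"
    using \<mu>(2) \<delta>(2) \<gamma> unfolding \<Phi>_def[symmetric] by (simp add: \<gamma>_def)
  moreover have "max_proj_const n - \<epsilon> \<le> op_norm_on ?F ?P"
    using lowQ[OF P] max_proj_const_le[OF assms(1)] x(2) \<mu> \<delta>(2) \<gamma>
    unfolding \<Phi>_def[symmetric] x0 by (simp add: \<gamma>_def)
  moreover have "dim ?E = n"
    unfolding frame_span_def by (rule dim_span_orthonormal[OF _ b]) simp
  moreover have "subspace ?E" by (simp add: frame_span_def)
  ultimately show ?thesis
    using d frame_span_subset[of d n b] frame_projection_orthogonal[OF b]
    by (intro exI[of _ d] exI[of _ ?E] exI[of _ ?P] conjI)
qed

end
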